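(* Fix $d\ge3$, let $q$ be an odd prime power, $Q$ a nondegenerate quadratic form on $\mathbb F_q^d$, and use the sphere family $\mathcal S_{\mathrm{rn}}=\{S_t:t\in\mathbb F_q\}$, the set $\mathfrak A_{d,\gamma}$ and the points $p_A$ ($A\in\mathfrak A_{d,\gamma}$) constructed in the context. For every $d$-uniform hypergraph $\mathcal G\subseteq\mathfrak A_{d,\gamma}$ on the label set $\mathbb F_q$, put $P_{\mathcal G}=\{p_A:A\in\mathcal G\}$. Then, for $A\in\mathcal G$ and $t\in\mathbb F_q$, $$p_A\in S_t\iff t\in A,$$ so the point–sphere incidence graph of $(P_{\mathcal G},\mathcal S_{\mathrm{rn}})$ is exactly the membership graph of $\mathcal G$. If $m=|\mathcal G|$, then $$I(P_{\mathcal G},\mathcal S_{\mathrm{rn}})=dm,\qquad\sigma(P_{\mathcal G},\mathcal S_{\mathrm{rn}})=(d-1)m,\qquad K_{\mathcal G}=\frac{(d-1)\sqrt m}{q^{d/2}},$$ where (for $m>0$) $K_{\mathcal G}$ is defined by $\sigma(P_{\mathcal G},\mathcal S_{\mathrm{rn}})=K_{\mathcal G}q^{(d-1)/2}\sqrt{|P_{\mathcal G}||\mathcal S_{\mathrm{rn}}|}$. In particular, $$K_{\mathcal G}^2q^{d-1}|\mathcal S_{\mathrm{rn}}|=(d-1)^2m\ge4m,$$ so every nonempty member of this class satisfies $K_{\mathcal G}^2q^{d-1}|\mathcal S_{\mathrm{rn}}|\ge4|P_{\mathcal G}|$. For each fixed $\rho>0$, all systems with $m\ge\rho|\mathfrak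 A_{d,\gamma}|$ have $K_{\mathcal G}\asymp_{d,\rho}1$ (bounded above and below by positive constants depending only on $d,\rho$, as $q\to\infty$). For sufficiently large $q$ they lie in the moderate range $$\frac{4|P_{\mathcal G}|}{K_{\mathcal G}^2q^{d-1}}\le|\mathcal S_{\mathrm{rn}}|\le C_1K_{\mathcal G}q^{(d-1)/2}$$ with $C_1=1$ when $d\ge4$, and with every fixed $C_1>\sqrt{\frac3{2\rho}}$ when $d=3$.
   Context: Put $\langle x,y\rangle_Q=\frac{Q(x+y)-Q(x)-Q(y)}2$ and $S_Q(c,r)=\{x:Q(x-c)=r\}$; spheres are parametrized by pairs $(c,r)$. $I(P,\mathcal S)=|\{(p,S)\in P\times\mathcal S:p\in S\}|$, $\sigma(P,\mathcal S)=I(P,\mathcal S)-|P||\mathcal S|/q$. Construction. Use a Witt decomposition $\mathbb F_q^d=\mathbb F_qe\oplus\mathbb F_qf\oplus V_0$ with $Q(xe+yf+z)=xy+Q_\perp(z)$, $Q_\perp$ nondegenerate on the $(d-2)$-dimensional space $V_0$. Fix a basis $u_1,\dots,u_{d-2}$ of $V_0$ and put, for $t\in\mathbb F_q$, $$z_t=\sum_{j=1}^{d-2}t^ju_j,\qquad c_t=t^{d-1}f+z_t,\qquad\gamma=-1-Q(c_1),\qquad g(t)=Q(c_t)+t^d+\gamma t^{d-1}.$$ The map $g:\mathbb F_q\to\mathbb F_q$ is not surjective (as $g(0)=g(1)=0$); choose $\kappa\in\mathbb F_q$ with $-\kappa\notin g(\mathbb F_q)$ and put $$b_t=t^d+\gamma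 t^{d-1}+\kappa,\qquad r_t=Q(c_t)+b_t,\qquad S_t=S_Q(c_t,r_t).$$ The map $$\Psi(xe+yf+z)(T)=T^d+(x+\gamma)T^{d-1}+\sum_{j=1}^{d-2}2\langle z,u_j\rangle_QT^j+\kappa-Q(xe+yf+z)$$ is a bijection from $\{xe+yf+z:x\in\mathbb F_q^\times,\ y\in\mathbb F_q,\ z\in V_0\}$ onto the set of monic degree-$d$ polynomials over $\mathbb F_q$ whose $T^{d-1}$-coefficient is not $\gamma$. Let $$\mathfrak A_{d,\gamma}=\Bigl\{A\subseteq\mathbb F_q:|A|=d,\ -\sum_{a\in A}a\ne\gamma\Bigr\},$$ and for $A\in\mathfrak A_{d,\gamma}$ let $p_A$ be the point with $\Psi(p_A)=\prod_{a\in A}(T-a)$. *)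

theory Defs
  imports Complex_Main "HOL-Library.FuncSet" "HOL-Algebra.UnivPoly"
begin

text \<open>
  Finite fields are HOL-Algebra records rather than types, because the asymptotic claims
  quantify over all fields \<open>F\<^sub>q\<close> with constants that must not depend on the field.  The carrier
  type \<open>'a\<close> is arbitrary; every finite field is isomorphic to one whose carrier is a set of
  naturals, so already the instance \<open>'a = nat\<close> ranges over all finite fields.
\<close>

subsection \<open>Quadratic spaces\<close>

text \<open>The fields \<open>mult\<close> and \<open>one\<close>, inherited from the ring record, play no role in a module.\<close>

definition coord_space :: "'a ring \<Rightarrow> nat \<Rightarrow> ('a, nat \<Rightarrow> 'a) module" where
  "coord_space F d = \<lparr>
     carrier = {..<d} \<rightarrow>\<^sub>E carrier F,
     mult = undefined,
     one = undefined,
     zero = (\<lambda>i\<in>{..<d}. \<zero>\<^bsub>F\<^esub>),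
     add = (\<lambda>v w. \<lambda>i\<in>{..<d}. v i \<oplus>\<^bsub>F\<^esub> w i),
     smult = (\<lambda>a v. \<lambda>i\<in>{..<d}. a \<otimes>\<^bsub>F\<^esub> v i)\<rparr>"

definition qinner :: "'a ring \<Rightarrow> ('a, 'v) module \<Rightarrow> ('v \<Rightarrow> 'a) \<Rightarrow> 'v \<Rightarrow> 'v \<Rightarrow> 'a" where
  "qinner F V Q v w =
     (Q (v \<oplus>\<^bsub>V\<^esub> w) \<ominus>\<^bsub>F\<^esub> Q v \<ominus>\<^bsub>F\<^esub> Q w) \<otimes>\<^bsub>F\<^esub> inv\<^bsub>F\<^esub> ([(2::nat)] \<cdot>\<^bsub>F\<^esub> \<one>\<^bsub>F\<^esub>)"

text \<open>Linearity in the second argument follows by symmetry of \<^const>\<open>qinner\<close>.\<close>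

definition quadratic_form :: "'a ring \<Rightarrow> ('a, 'v) module \<Rightarrow> ('v \<Rightarrow> 'a) \<Rightarrow> bool" where
  "quadratic_form F V Q \<longleftrightarrow>
     Q \<in> carrier V \<rightarrow> carrier F \<and>
     (\<forall>a\<in>carrier F. \<forall>v\<in>carrier V. Q (a \<odot>\<^bsub>V\<^esub> v) = a [^]\<^bsub>F\<^esub> (2::nat) \<otimes>\<^bsub>F\<^esub> Q v) \<and>
     (\<forall>u\<in>carrier V. \<forall>v\<in>carrier V. \<forall>w\<in>carrier V.
        qinner F V Q (u \<oplus>\<^bsub>V\<^esub> v) w = qinner F V Q u w \<oplus>\<^bsub>F\<^esub> qinner F V Q v w) \<and>
     (\<forall>a\<in>carrier F. \<forall>v\<in>carrier V. \<forall>w\<in>carrier V.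
        qinner F V Q (a \<odot>\<^bsub>V\<^esub> v) w = a \<otimes>\<^bsub>F\<^esub> qinner F V Q v w)"

definition nondegenerate :: "'a ring \<Rightarrow> ('a, 'v) module \<Rightarrow> ('v \<Rightarrow> 'a) \<Rightarrow> bool" where
  "nondegenerate F V Q \<longleftrightarrow>
     (\<forall>v\<in>carrier V. (\<forall>w\<in>carrier V. qinner F V Q v w = \<zero>\<^bsub>F\<^esub>) \<longrightarrow> v = \<zero>\<^bsub>V\<^esub>)"

subsection \<open>Spheres and incidences\<close>

text \<open>A sphere is represented by its parameter pair \<open>(c, r)\<close>; families are sets of pairs.\<close>

type_synonym ('v, 'a) sphere = "'v \<times> 'a"

definition sphere_points :: "('a, 'v) module \<Rightarrow> ('v \<Rightarrow> 'a) \<Rightarrow> ('v, 'a) sphere \<Rightarrow> 'v set" where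
  "sphere_points V Q S = {x \<in> carrier V. Q (x \<ominus>\<^bsub>V\<^esub> fst S) = snd S}"

definition incidence_graph ::
    "('a, 'v) module \<Rightarrow> ('v \<Rightarrow> 'a) \<Rightarrow> 'v set \<Rightarrow> ('v, 'a) sphere set \<Rightarrow> ('v \<times> ('v, 'a) sphere) set" where
  "incidence_graph V Q P Sph = {(p, S) \<in> P \<times> Sph. p \<in> sphere_points V Q S}"

definition incidences ::
    "('a, 'v) module \<Rightarrow> ('v \<Rightarrow> 'a) \<Rightarrow> 'v set \<Rightarrow> ('v, 'a) sphere set \<Rightarrow> nat" where
  "incidences V Q P Sph = card (incidence_graph V Q P Sph)"

definition discrepancy ::
    "'a ring \<Rightarrow> ('a, 'v) module \<Rightarrow> ('v \<Rightarrow> 'a) \<Rightarrow> 'v set \<Rightarrow> ('v, 'a) sphere set \<Rightarrow> real" where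
  "discrepancy F V Q P Sph =
     real (incidences V Q P Sph) - real (card P) * real (card Sph) / real (card (carrier F))"

text \<open>The number \<open>K\<close> with \<open>\<sigma>(P, S) = K q\<^bsup>(d-1)/2\<^esup> (|P| |S|)\<^bsup>1/2\<^esup>\<close>;
  meaningful when \<open>P\<close> and \<open>S\<close> are nonempty.\<close>

definition K_const ::
    "'a ring \<Rightarrow> nat \<Rightarrow> ((nat \<Rightarrow> 'a) \<Rightarrow> 'a) \<Rightarrow> (nat \<Rightarrow> 'a) set \<Rightarrow> (nat \<Rightarrow> 'a, 'a) sphere set \<Rightarrow> real" where
  "K_const F d Q P Sph =
     discrepancy F (coord_space F d) Q P Sph /
       (real (card (carrier F)) powr ((real d - 1) / 2) * sqrt (real (card P) * real (card Sph)))"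

subsection \<open>The construction\<close>

text \<open>The choices on which the construction depends: a Witt decomposition
  \<open>F e \<oplus> F f \<oplus> V\<^sub>0\<close>, a basis \<open>u\<^sub>1, \<dots>, u\<^bsub>d-2\<^esub>\<close> of \<open>V\<^sub>0\<close>, and \<open>\<kappa>\<close>.\<close>

record 'a rn_choice =
  rn_e :: "nat \<Rightarrow> 'a"
  rn_f :: "nat \<Rightarrow> 'a"
  rn_V0 :: "(nat \<Rightarrow> 'a) set"
  rn_u :: "nat \<Rightarrow> nat \<Rightarrow> 'a"
  rn_kappa :: 'a

definition rn_pt :: "'a ring \<Rightarrow> nat \<Rightarrow> 'a rn_choice \<Rightarrow> 'a \<Rightarrow> 'a \<Rightarrow> (nat \<Rightarrow> 'a) \<Rightarrow> (nat \<Rightarrow> 'a)" where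
  "rn_pt F d W x y z =
     (x \<odot>\<^bsub>coord_space F d\<^esub> rn_e W) \<oplus>\<^bsub>coord_space F d\<^esub>
     (y \<odot>\<^bsub>coord_space F d\<^esub> rn_f W) \<oplus>\<^bsub>coord_space F d\<^esub> z"

text \<open>\<open>Q\<^sub>\<bottom>\<close> is the restriction of \<open>Q\<close> to \<open>V\<^sub>0\<close> (put \<open>x = y = 0\<close> in \<open>Q(xe + yf + z) = xy + Q\<^sub>\<bottom>(z)\<close>).\<close>

definition witt_decomposition :: "'a ring \<Rightarrow> nat \<Rightarrow> ((nat \<Rightarrow> 'a) \<Rightarrow> 'a) \<Rightarrow> 'a rn_choice \<Rightarrow> bool" where
  "witt_decomposition F d Q W \<longleftrightarrow>
     rn_e W \<in> carrier (coord_space F d) \<and>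
     rn_f W \<in> carrier (coord_space F d) \<and>
     submodule (rn_V0 W) F (coord_space F d) \<and>
     (\<forall>v\<in>carrier (coord_space F d).
        \<exists>!(x, y, z). x \<in> carrier F \<and> y \<in> carrier F \<and> z \<in> rn_V0 W \<and> v = rn_pt F d W x y z) \<and>
     (\<forall>x\<in>carrier F. \<forall>y\<in>carrier F. \<forall>z\<in>rn_V0 W.
        Q (rn_pt F d W x y z) = x \<otimes>\<^bsub>F\<^esub> y \<oplus>\<^bsub>F\<^esub> Q z) \<and>
     nondegenerate F ((coord_space F d)\<lparr>carrier := rn_V0 W\<rparr>) Q"

definition rn_basis :: "'a ring \<Rightarrow> nat \<Rightarrow> 'a rn_choice \<Rightarrow> bool" where
  "rn_basis F d W \<longleftrightarrow>
     (\<forall>j\<in>{1..d-2}. rn_u W j \<in> rn_V0 W) \<and>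
     (\<forall>z\<in>rn_V0 W. \<exists>!a. a \<in> {1..d-2} \<rightarrow>\<^sub>E carrier F \<and>
        z = (\<Oplus>\<^bsub>coord_space F d\<^esub> j\<in>{1..d-2}. a j \<odot>\<^bsub>coord_space F d\<^esub> rn_u W j))"

definition rn_z :: "'a ring \<Rightarrow> nat \<Rightarrow> 'a rn_choice \<Rightarrow> 'a \<Rightarrow> (nat \<Rightarrow> 'a)" where
  "rn_z F d W t =
     (\<Oplus>\<^bsub>coord_space F d\<^esub> j\<in>{1..d-2}. (t [^]\<^bsub>F\<^esub> j) \<odot>\<^bsub>coord_space F d\<^esub> rn_u W j)"

definition rn_center :: "'a ring \<Rightarrow> nat \<Rightarrow> 'a rn_choice \<Rightarrow> 'a \<Rightarrow> (nat \<Rightarrow> 'a)" where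
  "rn_center F d W t =
     ((t [^]\<^bsub>F\<^esub> (d-1)) \<odot>\<^bsub>coord_space F d\<^esub> rn_f W) \<oplus>\<^bsub>coord_space F d\<^esub> rn_z F d W t"

definition rn_gamma :: "'a ring \<Rightarrow> nat \<Rightarrow> ((nat \<Rightarrow> 'a) \<Rightarrow> 'a) \<Rightarrow> 'a rn_choice \<Rightarrow> 'a" where
  "rn_gamma F d Q W = \<ominus>\<^bsub>F\<^esub> \<one>\<^bsub>F\<^esub> \<ominus>\<^bsub>F\<^esub> Q (rn_center F d W \<one>\<^bsub>F\<^esub>)"

definition rn_g :: "'a ring \<Rightarrow> nat \<Rightarrow> ((nat \<Rightarrow> 'a) \<Rightarrow> 'a) \<Rightarrow> 'a rn_choice \<Rightarrow> 'a \<Rightarrow> 'a" where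
  "rn_g F d Q W t =
     Q (rn_center F d W t) \<oplus>\<^bsub>F\<^esub> t [^]\<^bsub>F\<^esub> d \<oplus>\<^bsub>F\<^esub> rn_gamma F d Q W \<otimes>\<^bsub>F\<^esub> t [^]\<^bsub>F\<^esub> (d-1)"

definition rn_b :: "'a ring \<Rightarrow> nat \<Rightarrow> ((nat \<Rightarrow> 'a) \<Rightarrow> 'a) \<Rightarrow> 'a rn_choice \<Rightarrow> 'a \<Rightarrow> 'a" where
  "rn_b F d Q W t =
     t [^]\<^bsub>F\<^esub> d \<oplus>\<^bsub>F\<^esub> rn_gamma F d Q W \<otimes>\<^bsub>F\<^esub> t [^]\<^bsub>F\<^esub> (d-1) \<oplus>\<^bsub>F\<^esub> rn_kappa W"

definition rn_sphere ::
    "'a ring \<Rightarrow> nat \<Rightarrow> ((nat \<Rightarrow> 'a) \<Rightarrow> 'a) \<Rightarrow> 'a rn_choice \<Rightarrow> 'a \<Rightarrow> (nat \<Rightarrow> 'a, 'a) sphere" where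
  "rn_sphere F d Q W t =
     (rn_center F d W t, Q (rn_center F d W t) \<oplus>\<^bsub>F\<^esub> rn_b F d Q W t)"

definition rn_spheres ::
    "'a ring \<Rightarrow> nat \<Rightarrow> ((nat \<Rightarrow> 'a) \<Rightarrow> 'a) \<Rightarrow> 'a rn_choice \<Rightarrow> (nat \<Rightarrow> 'a, 'a) sphere set" where
  "rn_spheres F d Q W = rn_sphere F d Q W ` carrier F"

text \<open>The polynomial \<open>\<Psi>(xe + yf + z)\<close>, as an element of the library's polynomial ring.\<close>

definition rn_Psi ::
    "'a ring \<Rightarrow> nat \<Rightarrow> ((nat \<Rightarrow> 'a) \<Rightarrow> 'a) \<Rightarrow> 'a rn_choice \<Rightarrow> 'a \<Rightarrow> 'a \<Rightarrow> (nat \<Rightarrow> 'a) \<Rightarrow> (nat \<Rightarrow> 'a)" where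
  "rn_Psi F d Q W x y z =
     monom (UP F) \<one>\<^bsub>F\<^esub> d
     \<oplus>\<^bsub>UP F\<^esub> monom (UP F) (x \<oplus>\<^bsub>F\<^esub> rn_gamma F d Q W) (d-1)
     \<oplus>\<^bsub>UP F\<^esub> (\<Oplus>\<^bsub>UP F\<^esub> j\<in>{1..d-2}.
               monom (UP F) ([(2::nat)] \<cdot>\<^bsub>F\<^esub> qinner F (coord_space F d) Q z (rn_u W j)) j)
     \<oplus>\<^bsub>UP F\<^esub> monom (UP F) (rn_kappa W \<ominus>\<^bsub>F\<^esub> Q (rn_pt F d W x y z)) 0"

definition rn_sets ::
    "'a ring \<Rightarrow> nat \<Rightarrow> ((nat \<Rightarrow> 'a) \<Rightarrow> 'a) \<Rightarrow> 'a rn_choice \<Rightarrow> 'a set set" where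
  "rn_sets F d Q W =
     {A. A \<subseteq> carrier F \<and> card A = d \<and> \<ominus>\<^bsub>F\<^esub> (\<Oplus>\<^bsub>F\<^esub> a\<in>A. a) \<noteq> rn_gamma F d Q W}"

definition rn_point ::
    "'a ring \<Rightarrow> nat \<Rightarrow> ((nat \<Rightarrow> 'a) \<Rightarrow> 'a) \<Rightarrow> 'a rn_choice \<Rightarrow> 'a set \<Rightarrow> (nat \<Rightarrow> 'a)" where
  "rn_point F d Q W A =
     (THE p. \<exists>x\<in>carrier F - {\<zero>\<^bsub>F\<^esub>}. \<exists>y\<in>carrier F. \<exists>z\<in>rn_V0 W.
        p = rn_pt F d W x y z \<and>
        rn_Psi F d Q W x y z =
          (\<Otimes>\<^bsub>UP F\<^esub> a\<in>A. monom (UP F) \<one>\<^bsub>F\<^esub> 1 \<ominus>\<^bsub>UP F\<^esub> monom (UP F) a 0))"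

definition rn_points ::
    "'a ring \<Rightarrow> nat \<Rightarrow> ((nat \<Rightarrow> 'a) \<Rightarrow> 'a) \<Rightarrow> 'a rn_choice \<Rightarrow> 'a set set \<Rightarrow> (nat \<Rightarrow> 'a) set" where
  "rn_points F d Q W G = rn_point F d Q W ` G"

definition rn_K ::
    "'a ring \<Rightarrow> nat \<Rightarrow> ((nat \<Rightarrow> 'a) \<Rightarrow> 'a) \<Rightarrow> 'a rn_choice \<Rightarrow> 'a set set \<Rightarrow> real" where
  "rn_K F d Q W G = K_const F d Q (rn_points F d Q W G) (rn_spheres F d Q W)"

text \<open>A finite field of odd order forces the order to be an odd prime power.\<close>

definition rn_setting :: "'a ring \<Rightarrow> nat \<Rightarrow> ((nat \<Rightarrow> 'a) \<Rightarrow> 'a) \<Rightarrow> 'a rn_choice \<Rightarrow> bool" where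
  "rn_setting F d Q W \<longleftrightarrow>
     field F \<and> finite (carrier F) \<and> odd (card (carrier F)) \<and>
     quadratic_form F (coord_space F d) Q \<and> nondegenerate F (coord_space F d) Q \<and>
     witt_decomposition F d Q W \<and> rn_basis F d W \<and>
     rn_kappa W \<in> carrier F \<and> \<ominus>\<^bsub>F\<^esub> rn_kappa W \<notin> rn_g F d Q W ` carrier F"

end

theory Submission
  imports Defs "HOL-Algebra.Multiplicative_Group" "HOL-Real_Asymp.Real_Asymp"
begin

text \<open>
  For \<open>p = xe + yf + z\<close> the condition \<open>Q(p - c\<^sub>t) = Q(c\<^sub>t) + b\<^sub>t\<close> expands to \<open>\<Psi>(p)(t) = 0\<close>, so
  \<open>p\<^sub>A\<close> lies on \<open>S\<^sub>t\<close> exactly when \<open>t\<close> is a root of \<open>\<Prod>(T - a)\<close>.  The polynomial \<open>\<Psi>(p)\<close>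
  determines \<open>p\<close> and can be prescribed coefficientwise: the coefficient of \<open>T\<^bsup>d-1\<^esup>\<close> gives \<open>x\<close>, the
  middle coefficients give \<open>z\<close> by nondegeneracy of \<open>V\<^sub>0\<close>, and since \<open>x \<noteq> 0\<close> the constant
  coefficient gives \<open>y\<close>.

  All the estimates follow from \<open>K = (d - 1) (m / q\<^bsup>d\<^esup>)\<^bsup>1/2\<^esup>\<close> and
  \<open>(q - d)\<^bsup>d\<^esup> / d! \<le> |rn_sets| \<le> q\<^bsup>d\<^esup>\<close>.  For the lower bound, a \<open>d\<close>-set with prescribed sum is
  determined by any \<open>d - 1\<close> of its elements, so there are at most \<open>(q choose (d - 1)) / d\<close> of them.
\<close>

subsection \<open>Quadratic forms on modules\<close>

text \<open>If \<open>2 = 0\<close>, the additive order of \<open>\<one>\<close> divides 2 and, by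
  Lagrange, also the odd order of the additive group. It is then 1, which forces
  \<open>\<one> = \<zero>\<close>.\<close>

lemma (in ring) two_nonzero_of_odd_card:
  assumes "finite (carrier R)" "odd (card (carrier R))" "\<one> \<noteq> \<zero>"
  shows "[(2::nat)] \<cdot> \<one> \<noteq> \<zero>"
proof
  assume *: "[(2::nat)] \<cdot> \<one> = \<zero>"
  have "\<one> [^]\<^bsub>add_monoid R\<^esub> (2::nat) = \<one>\<^bsub>add_monoid R\<^esub>"
    using * by (simp add: add_pow_def)
  hence "group.ord (add_monoid R) \<one> dvd 2" using group.pow_eq_id[OF a_group, of \<one> 2] by simp
  moreover have "group.ord (add_monoid R) \<one> dvd card (carrier R)"
    using group.ord_dvd_group_order[OF a_group, of \<one>] by (simp add: order_def)
  ultimately have "group.ord (add_monoid R) \<one> \<noteq> 2" "group.ord (add_monoid R) \<one> dvd 2"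
    using assms(2) by auto
  hence "group.ord (add_monoid R) \<one> = 1"
    using dvd_imp_le[of "group.ord (add_monoid R) \<one>" 2]
    by (cases "group.ord (add_monoid R) \<one> = 0") auto
  thus False using group.ord_eq_1[OF a_group, of \<one>] assms(3) by simp
qed

text \<open>All axioms are checked coordinatewise. The vectors are extensional functions, so
  agreement on the indices below \<open>d\<close> already gives equality.\<close>

lemma module_coord_space:
  fixes F :: "'a ring"
  assumes "cring F"
  shows "module F (coord_space F d)"
proof -
  interpret cring F by fact
  have ext: "v = w" if "v \<in> carrier (coord_space F d)" "w \<in> carrier (coord_space F d)"
      "\<And>i. i < d \<Longrightarrow> v i = w i" for v w
    using that by (intro PiE_ext[of v "{..<d}" "\<lambda>_. carrier F" w]) (auto simp: coord_space_def)
  have [simp]: "i < d \<Longrightarrow> v \<in> carrier (coord_space F d) \<Longrightarrow> v i \<in> carrier F" for v i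
    by (auto simp: coord_space_def)
  have [simp]: "i < d \<Longrightarrow> (v \<oplus>\<^bsub>coord_space F d\<^esub> w) i = v i \<oplus>\<^bsub>F\<^esub> w i" for v w i
    by (simp add: coord_space_def)
  have [simp]: "i < d \<Longrightarrow> (a \<odot>\<^bsub>coord_space F d\<^esub> w) i = a \<otimes>\<^bsub>F\<^esub> w i" for a w i
    by (simp add: coord_space_def)
  have [simp]: "i < d \<Longrightarrow> \<zero>\<^bsub>coord_space F d\<^esub> i = \<zero>\<^bsub>F\<^esub>" for i
    by (simp add: coord_space_def)
  have add: "v \<oplus>\<^bsub>coord_space F d\<^esub> w \<in> carrier (coord_space F d)"
    if "v \<in> carrier (coord_space F d)" "w \<in> carrier (coord_space F d)" for v w
    using that by (auto simp: coord_space_def)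
  have smult: "a \<odot>\<^bsub>coord_space F d\<^esub> w \<in> carrier (coord_space F d)"
    if "a \<in> carrier F" "w \<in> carrier (coord_space F d)" for a w
    using that by (auto simp: coord_space_def)
  have zero: "\<zero>\<^bsub>coord_space F d\<^esub> \<in> carrier (coord_space F d)"
    by (auto simp: coord_space_def)
  have group: "abelian_group (coord_space F d)"
  proof (rule abelian_groupI)
    fix v assume v: "v \<in> carrier (coord_space F d)"
    show "\<exists>w\<in>carrier (coord_space F d). w \<oplus>\<^bsub>coord_space F d\<^esub> v = \<zero>\<^bsub>coord_space F d\<^esub>"
      by (rule bexI[of _ "(\<ominus>\<^bsub>F\<^esub> \<one>\<^bsub>F\<^esub>) \<odot>\<^bsub>coord_space F d\<^esub> v"])
        (auto intro!: ext add smult zero simp: v l_minus l_neg)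
  qed (auto intro!: ext intro: add zero simp: add a_ac)
  show ?thesis
    by (rule moduleI[OF cring_axioms group])
      (auto intro!: ext intro: add smult simp: add smult l_distr r_distr m_assoc)
qed

locale quadratic_space = module F V for F :: "'a ring" (structure) and V :: "('a, 'v) module" +
  fixes Q :: "'v \<Rightarrow> 'a"
  assumes field_scalars: "field F"
    and two_nonzero: "[(2::nat)] \<cdot> \<one> \<noteq> \<zero>"
    and quadratic: "quadratic_form F V Q"
begin

sublocale F: field F by (rule field_scalars)

abbreviation B where "B \<equiv> qinner F V Q"

lemma Q_closed [simp, intro]: "v \<in> carrier V \<Longrightarrow> Q v \<in> carrier F"
  using quadratic by (auto simp: quadratic_form_def)

lemma Q_smult:
  "a \<in> carrier F \<Longrightarrow> v \<in> carrier V \<Longrightarrow> Q (a \<odot>\<^bsub>V\<^esub> v) = a [^] (2::nat) \<otimes> Q v"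
  using quadratic by (auto simp: quadratic_form_def)

lemma two_closed [simp, intro]: "[(2::nat)] \<cdot> \<one> \<in> carrier F"
  by simp

lemma inv_two_closed [simp, intro]: "inv ([(2::nat)] \<cdot> \<one>) \<in> carrier F"
  using two_nonzero by (intro R.Units_inv_closed) (simp add: F.field_Units)

lemma qinner_closed [simp, intro]: "v \<in> carrier V \<Longrightarrow> w \<in> carrier V \<Longrightarrow> B v w \<in> carrier F"
  by (simp add: qinner_def)

lemma qinner_add_left:
  "u \<in> carrier V \<Longrightarrow> v \<in> carrier V \<Longrightarrow> w \<in> carrier V \<Longrightarrow> B (u \<oplus>\<^bsub>V\<^esub> v) w = B u w \<oplus> B v w"
  using quadratic by (auto simp: quadratic_form_def)

lemma qinner_smult_left:
  "a \<in> carrier F \<Longrightarrow> v \<in> carrier V \<Longrightarrow> w \<in> carrier V \<Longrightarrow> B (a \<odot>\<^bsub>V\<^esub> v) w = a \<otimes> B v w"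
  using quadratic by (auto simp: quadratic_form_def)

lemma qinner_sym:
  assumes "v \<in> carrier V" "w \<in> carrier V"
  shows "B v w = B w v"
proof -
  have "Q (v \<oplus>\<^bsub>V\<^esub> w) \<ominus> Q v \<ominus> Q w = Q (w \<oplus>\<^bsub>V\<^esub> v) \<ominus> Q w \<ominus> Q v"
    using assms by (simp add: M.a_comm[of v w] a_minus_def R.a_assoc R.a_comm[of "\<ominus> Q v"])
  thus ?thesis by (simp add: qinner_def)
qed

lemma two_times: "a \<in> carrier F \<Longrightarrow> [(2::nat)] \<cdot> a = a \<oplus> a"
  by (simp add: numeral_2_eq_2)

text \<open>Doubling clears the division in \<open>qinner\<close>. Later identities are therefore
  stated for twice \<open>B\<close>, where they are polynomial and within reach of
  \<open>algebra\<close>.\<close>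

lemma two_qinner:
  assumes "v \<in> carrier V" "w \<in> carrier V"
  shows "[(2::nat)] \<cdot> B v w = Q (v \<oplus>\<^bsub>V\<^esub> w) \<ominus> Q v \<ominus> Q w"
proof -
  have "[(2::nat)] \<cdot> B v w = B v w \<otimes> ([(2::nat)] \<cdot> \<one>)"
    using assms by (simp add: add_pow_rdistr)
  also have "\<dots> = (Q (v \<oplus>\<^bsub>V\<^esub> w) \<ominus> Q v \<ominus> Q w) \<otimes> (inv ([(2::nat)] \<cdot> \<one>) \<otimes> ([(2::nat)] \<cdot> \<one>))"
    using assms by (simp add: qinner_def R.m_assoc)
  also have "inv ([(2::nat)] \<cdot> \<one>) \<otimes> ([(2::nat)] \<cdot> \<one>) = \<one>"
    using two_nonzero by (intro R.Units_l_inv) (simp add: F.field_Units)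
  finally show ?thesis using assms by simp
qed

lemma two_cancel:
  assumes "a \<in> carrier F" "b \<in> carrier F" "[(2::nat)] \<cdot> a = [(2::nat)] \<cdot> b"
  shows "a = b"
proof -
  have "([(2::nat)] \<cdot> \<one>) \<otimes> a = ([(2::nat)] \<cdot> \<one>) \<otimes> b"
    using assms by (simp add: add_pow_ldistr)
  thus ?thesis using two_nonzero assms by (simp add: F.m_lcancel)
qed

lemma Q_add:
  assumes "v \<in> carrier V" "w \<in> carrier V"
  shows "Q (v \<oplus>\<^bsub>V\<^esub> w) = Q v \<oplus> Q w \<oplus> [(2::nat)] \<cdot> B v w"
proof -
  have c: "Q (v \<oplus>\<^bsub>V\<^esub> w) \<in> carrier F" "Q v \<in> carrier F" "Q w \<in> carrier F" using assms by auto
  have "Q v \<oplus> Q w \<oplus> (Q (v \<oplus>\<^bsub>V\<^esub> w) \<ominus> Q v \<ominus> Q w) = Q (v \<oplus>\<^bsub>V\<^esub> w)"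
    using c by algebra
  thus ?thesis using two_qinner[OF assms] by simp
qed

text \<open>Apply \<open>Q_add\<close> to \<open>v\<close> and \<open>(-1) w\<close>, using
  \<open>(-1)^2 = 1\<close> in \<open>Q\<close> and linearity in \<open>B\<close>. This is the
  expansion needed for sphere equations.\<close>

lemma Q_diff:
  assumes "v \<in> carrier V" "w \<in> carrier V"
  shows "Q (v \<ominus>\<^bsub>V\<^esub> w) = Q v \<oplus> Q w \<ominus> [(2::nat)] \<cdot> B v w"
proof -
  have neg: "\<ominus>\<^bsub>V\<^esub> w = (\<ominus> \<one>) \<odot>\<^bsub>V\<^esub> w"
    using assms by (simp add: smult_l_minus)
  have "Q (\<ominus>\<^bsub>V\<^esub> w) = Q w"
    using assms unfolding neg by (simp add: Q_smult numeral_2_eq_2 R.l_minus R.r_minus)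
  moreover have "B v (\<ominus>\<^bsub>V\<^esub> w) = \<ominus> B v w"
    using assms qinner_smult_left[of "\<ominus> \<one>" w v]
    by (simp add: neg qinner_sym[of v] R.l_minus)
  ultimately show ?thesis
    using assms Q_add[of v "\<ominus>\<^bsub>V\<^esub> w"]
    by (simp add: M.minus_eq R.minus_eq two_times R.minus_add)
qed

lemma qinner_finsum_right:
  assumes "v \<in> carrier V" "finite J" "g \<in> J \<rightarrow> carrier V"
  shows "B v (\<Oplus>\<^bsub>V\<^esub> j\<in>J. g j) = (\<Oplus> j\<in>J. B v (g j))"
  using assms(2,3)
proof (induction J rule: finite_induct)
  case empty
  \<comment> \<open>Writing the zero vector as a scalar multiple by \<open>\<zero>\<close> lets
    homogeneity show that its pairing with \<open>v\<close> vanishes.\<close>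
  have "B (\<zero> \<odot>\<^bsub>V\<^esub> \<zero>\<^bsub>V\<^esub>) v = \<zero>"
    using assms(1) by (subst qinner_smult_left) auto
  thus ?case using assms(1) by (simp add: qinner_sym[of v])
next
  case (insert i J)
  have "B (g i \<oplus>\<^bsub>V\<^esub> (\<Oplus>\<^bsub>V\<^esub> j\<in>J. g j)) v = B (g i) v \<oplus> B (\<Oplus>\<^bsub>V\<^esub> j\<in>J. g j) v"
    using insert assms(1) by (intro qinner_add_left M.finsum_closed) auto
  moreover have "(\<Oplus>\<^bsub>V\<^esub> j\<in>J. g j) \<in> carrier V" "g i \<in> carrier V"
    using insert by (auto intro: M.finsum_closed)
  ultimately show ?case using insert assms(1)
    by (simp add: Pi_def qinner_sym[of v])
qed

lemma two_finsum:
  assumes "finite J" "g \<in> J \<rightarrow> carrier F"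
  shows "[(2::nat)] \<cdot> (\<Oplus> j\<in>J. g j) = (\<Oplus> j\<in>J. [(2::nat)] \<cdot> g j)"
proof -
  have "[(2::nat)] \<cdot> (\<Oplus> j\<in>J. g j) = ([(2::nat)] \<cdot> \<one>) \<otimes> (\<Oplus> j\<in>J. g j)"
    using assms by (subst add_pow_ldistr) (auto intro: R.finsum_closed)
  also have "\<dots> = (\<Oplus> j\<in>J. ([(2::nat)] \<cdot> \<one>) \<otimes> g j)"
    using assms by (subst R.finsum_rdistr) auto
  also have "\<dots> = (\<Oplus> j\<in>J. [(2::nat)] \<cdot> g j)"
    using assms by (intro R.finsum_cong') (auto simp: add_pow_ldistr Pi_iff)
  finally show ?thesis .
qed

end

subsection \<open>Products of linear factors\<close>

context UP_cring
begin

abbreviation lin_prod where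
  "lin_prod A \<equiv> (\<Otimes>\<^bsub>P\<^esub> a\<in>A. monom P \<one> 1 \<ominus>\<^bsub>P\<^esub> monom P a 0)"

lemma lin_prod_closed: "A \<subseteq> carrier R \<Longrightarrow> lin_prod A \<in> carrier P"
  by (intro P.finprod_closed) auto

text \<open>Multiplication by \<open>T\<close> shifts the coefficients and multiplication by the
  constant \<open>a\<close> scales them. The resulting recurrence drives the induction for products
  of linear factors.\<close>

lemma coeff_lin_factor_mult_Suc:
  assumes "a \<in> carrier R" "p \<in> carrier P"
  shows "coeff P ((monom P \<one> 1 \<ominus>\<^bsub>P\<^esub> monom P a 0) \<otimes>\<^bsub>P\<^esub> p) (Suc n) = coeff P p n \<ominus> a \<otimes> coeff P p (Suc n)"
proof -
  have "(monom P \<one> 1 \<ominus>\<^bsub>P\<^esub> monom P a 0) \<otimes>\<^bsub>P\<^esub> p = monom P \<one> 1 \<otimes>\<^bsub>P\<^esub> p \<ominus>\<^bsub>P\<^esub> monom P a 0 \<otimes>\<^bsub>P\<^esub> p"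
    using assms by (simp add: P.minus_eq P.l_distr P.l_minus)
  moreover have "coeff P (monom P \<one> 1 \<otimes>\<^bsub>P\<^esub> p) (n + 1) = \<one> \<otimes> coeff P p n"
    using assms by (intro coeff_monom_mult) auto
  moreover have "coeff P (monom P a 0 \<otimes>\<^bsub>P\<^esub> p) (Suc n + 0) = a \<otimes> coeff P p (Suc n)"
    using assms by (intro coeff_monom_mult) auto
  ultimately show ?thesis using assms by simp
qed

text \<open>Degree bound, leading coefficient and the first Vieta formula go through one induction,
  since the recurrence for each uses the others. For empty \<open>A\<close> the truncated index
  \<open>card A - 1\<close> would be 0, where the coefficient is \<open>\<one>\<close>, hence the
  side condition.\<close>

lemma coeff_lin_prod:
  assumes "finite A" "A \<subseteq> carrier R"
  shows "(\<forall>n>card A. coeff P (lin_prod A) n = \<zero>) \<and> coeff P (lin_prod A) (card A) = \<one> \<and>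
    (A \<noteq> {} \<longrightarrow> coeff P (lin_prod A) (card A - 1) = \<ominus> (\<Oplus> a\<in>A. a))"
  using assms
proof (induction A rule: finite_induct)
  case empty
  then show ?case by simp
next
  case (insert a A)
  let ?p = "lin_prod A"
  have a: "a \<in> carrier R" and A: "A \<subseteq> carrier R" using insert by auto
  have p: "?p \<in> carrier P" by (rule lin_prod_closed[OF A])
  have sA: "(\<Oplus> a\<in>A. a) \<in> carrier R" using A by (intro R.finsum_closed) auto
  have eq: "lin_prod (insert a A) = (monom P \<one> 1 \<ominus>\<^bsub>P\<^esub> monom P a 0) \<otimes>\<^bsub>P\<^esub> ?p"
    using insert A a by (intro P.finprod_insert) auto
  note c = coeff_lin_factor_mult_Suc[OF a p]
  have "coeff P (lin_prod (insert a A)) n = \<zero>" if n: "n > card (insert a A)" for n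
  proof -
    obtain k where "n = Suc k" "k > card A" using n insert.hyps by (cases n) simp_all
    thus ?thesis using insert.IH[OF A] a c[of k] eq by (simp add: R.minus_eq)
  qed
  moreover have "coeff P (lin_prod (insert a A)) (card (insert a A)) = \<one>"
    using insert.IH[OF A] a c[of "card A"] eq insert.hyps by (simp add: R.minus_eq)
  moreover have "coeff P (lin_prod (insert a A)) (card (insert a A) - 1) = \<ominus> (\<Oplus> a\<in>insert a A. a)"
  proof (cases "A = {}")
    case True
    thus ?thesis using a by (simp add: R.minus_eq)
  next
    case False
    \<comment> \<open>Nonemptiness makes \<open>card A\<close> a successor, so the recurrence
      applies at index \<open>card A - 1\<close>.\<close>
    hence "card A = Suc (card A - 1)" using insert.hyps by (simp add: card_gt_0_iff)
    hence "coeff P (lin_prod (insert a A)) (card A) = coeff P ?p (card A - 1) \<ominus> a \<otimes> coeff P ?p (card A)"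
      using c[of "card A - 1"] eq by simp
    also have "\<dots> = \<ominus> (\<Oplus> a\<in>A. a) \<ominus> a"
      using insert.IH[OF A] a False by simp
    also have "\<dots> = \<ominus> (\<Oplus> a\<in>insert a A. a)"
      using insert.hyps a A sA
      by (simp add: R.minus_eq R.minus_add subset_iff Pi_iff R.add.m_comm)
    finally show ?thesis using insert.hyps by simp
  qed
  ultimately show ?case by blast
qed

text \<open>This is the universal property of the polynomial ring with the identity as coefficient
  homomorphism.\<close>

lemma ring_hom_cring_eval: "t \<in> carrier R \<Longrightarrow> ring_hom_cring P R (eval R R id t)"
proof -
  assume t: "t \<in> carrier R"
  interpret UP_pre_univ_prop R R id P
    by unfold_locales simp
  show ?thesis by (rule ring_homD) (rule eval_ring_hom[OF t])
qed

lemma eval_monom_id: "t \<in> carrier R \<Longrightarrow> a \<in> carrier R \<Longrightarrow> eval R R id t (monom P a n) = a \<otimes> t [^] n"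
proof -
  assume t: "t \<in> carrier R" "a \<in> carrier R"
  interpret UP_pre_univ_prop R R id P
    by unfold_locales simp
  show ?thesis using eval_monom[of a t n] t by simp
qed

end

text \<open>Evaluation at \<open>t\<close> is a ring homomorphism taking \<open>T - a\<close> to
  \<open>t - a\<close>, and in a domain a product vanishes only if one of its factors does.\<close>

lemma (in UP_domain) eval_lin_prod_eq_zero:
  assumes "finite A" "A \<subseteq> carrier R" "t \<in> carrier R"
  shows "eval R R id t (lin_prod A) = \<zero> \<longleftrightarrow> t \<in> A"
  using assms(1,2)
proof (induction A rule: finite_induct)
  case empty
  interpret E: ring_hom_cring P R "eval R R id t"
    by (rule ring_hom_cring_eval[OF assms(3)])
  have "eval R R id t (lin_prod {}) = \<one>"
    unfolding P.finprod_empty by (rule E.hom_one)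
  thus ?case by (simp only: R.one_not_zero empty_iff)
next
  case (insert a A)
  interpret E: ring_hom_cring P R "eval R R id t"
    by (rule ring_hom_cring_eval[OF assms(3)])
  have a: "a \<in> carrier R" and A: "A \<subseteq> carrier R" using insert by auto
  have eq: "lin_prod (insert a A) = (monom P \<one> 1 \<ominus>\<^bsub>P\<^esub> monom P a 0) \<otimes>\<^bsub>P\<^esub> lin_prod A"
    using insert A a by (intro P.finprod_insert) auto
  have "eval R R id t (monom P \<one> 1 \<ominus>\<^bsub>P\<^esub> monom P a 0) = t \<ominus> a"
    using a assms(3) by (simp add: eval_monom_id P.minus_eq R.minus_eq)
  hence "eval R R id t (lin_prod (insert a A)) = (t \<ominus> a) \<otimes> eval R R id t (lin_prod A)"
    using a lin_prod_closed[OF A] unfolding eq by simp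
  moreover have "eval R R id t (lin_prod A) \<in> carrier R"
    using lin_prod_closed[OF A] by simp
  ultimately have "eval R R id t (lin_prod (insert a A)) = \<zero>
      \<longleftrightarrow> t \<ominus> a = \<zero> \<or> eval R R id t (lin_prod A) = \<zero>"
    using R.integral_iff[OF R.minus_closed[OF assms(3) a]] by (simp only:)
  also have "\<dots> \<longleftrightarrow> t = a \<or> t \<in> A"
    using insert.IH[OF A] a assms(3) by (simp only: R.r_right_minus_eq)
  finally show ?case by (simp only: insert_iff)
qed

subsection \<open>Points and spheres\<close>

locale rn_construction =
  fixes F :: "'a ring" (structure) and d :: nat and Q :: "(nat \<Rightarrow> 'a) \<Rightarrow> 'a" and W :: "'a rn_choice"
  assumes setting: "rn_setting F d Q W" and d_ge_3: "3 \<le> d"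
begin

abbreviation "V \<equiv> coord_space F d"
abbreviation "V\<^sub>0 \<equiv> rn_V0 W"
abbreviation "pt \<equiv> rn_pt F d W"
abbreviation "u \<equiv> rn_u W"
abbreviation "\<gamma> \<equiv> rn_gamma F d Q W"
abbreviation "\<kappa> \<equiv> rn_kappa W"
abbreviation "zc \<equiv> rn_z F d W"
abbreviation "center \<equiv> rn_center F d W"
abbreviation "lincomb a \<equiv> (\<Oplus>\<^bsub>V\<^esub> j\<in>{1..d-2}. a j \<odot>\<^bsub>V\<^esub> u j)"
abbreviation "\<Psi> \<equiv> rn_Psi F d Q W"
abbreviation "point \<equiv> rn_point F d Q W"
abbreviation "sphere \<equiv> rn_sphere F d Q W"

end

sublocale rn_construction \<subseteq> quadratic_space F "coord_space F d" Q
proof -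
  interpret F: field F using setting by (simp add: rn_setting_def)
  interpret module F "coord_space F d" by (rule module_coord_space) unfold_locales
  show "quadratic_space F (coord_space F d) Q"
    by unfold_locales
      (use setting F.two_nonzero_of_odd_card in \<open>auto simp: rn_setting_def\<close>)
qed

sublocale rn_construction \<subseteq> U: UP_domain F "UP F"
  by unfold_locales

context rn_construction
begin

section \<open>Computing in the Witt decomposition\<close>

lemma finite_carrier: "finite (carrier F)"
  using setting by (simp add: rn_setting_def)

lemma kappa_closed [simp, intro]: "\<kappa> \<in> carrier F"
  using setting by (simp add: rn_setting_def)

lemma witt: "witt_decomposition F d Q W"
  using setting by (simp add: rn_setting_def)

lemma basis: "rn_basis F d W"
  using setting by (simp add: rn_setting_def)

lemma e_closed [simp, intro]: "rn_e W \<in> carrier V" and f_closed [simp, intro]: "rn_f W \<in> carrier V"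
  and V0_submodule: "submodule V\<^sub>0 F V"
  using witt by (auto simp: witt_decomposition_def)

lemma V0_closed [simp]: "z \<in> V\<^sub>0 \<Longrightarrow> z \<in> carrier V"
  using submoduleE(1)[OF V0_submodule] by auto

lemma V0_add: "z \<in> V\<^sub>0 \<Longrightarrow> z' \<in> V\<^sub>0 \<Longrightarrow> z \<oplus>\<^bsub>V\<^esub> z' \<in> V\<^sub>0"
  using submoduleE(5)[OF V0_submodule] by auto

lemma V0_smult: "a \<in> carrier F \<Longrightarrow> z \<in> V\<^sub>0 \<Longrightarrow> a \<odot>\<^bsub>V\<^esub> z \<in> V\<^sub>0"
  using submoduleE(4)[OF V0_submodule] by auto

lemma V0_zero: "\<zero>\<^bsub>V\<^esub> \<in> V\<^sub>0"
  using submoduleE(2)[OF V0_submodule] V0_smult[of \<zero>] by auto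

lemma V0_diff: "z \<in> V\<^sub>0 \<Longrightarrow> z' \<in> V\<^sub>0 \<Longrightarrow> z \<ominus>\<^bsub>V\<^esub> z' \<in> V\<^sub>0"
  using submoduleE(3)[OF V0_submodule] by (simp add: M.minus_eq V0_add)

lemma V0_finsum: "finite J \<Longrightarrow> g \<in> J \<rightarrow> V\<^sub>0 \<Longrightarrow> (\<Oplus>\<^bsub>V\<^esub> j\<in>J. g j) \<in> V\<^sub>0"
proof (induction J rule: finite_induct)
  case (insert i J)
  thus ?case by (subst M.finsum_insert) (auto intro: V0_add simp: Pi_iff)
qed (simp add: V0_zero)

lemma u_V0: "j \<in> {1..d-2} \<Longrightarrow> u j \<in> V\<^sub>0"
  using basis by (auto simp: rn_basis_def)

lemma pt_closed [simp, intro]: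
  "x \<in> carrier F \<Longrightarrow> y \<in> carrier F \<Longrightarrow> z \<in> V\<^sub>0 \<Longrightarrow> pt x y z \<in> carrier V"
  by (simp add: rn_pt_def)

lemma pt_inj:
  assumes "pt x y z = pt x' y' z'" "x \<in> carrier F" "y \<in> carrier F" "z \<in> V\<^sub>0"
    "x' \<in> carrier F" "y' \<in> carrier F" "z' \<in> V\<^sub>0"
  shows "x = x'" "y = y'" "z = z'"
proof -
  have "\<exists>!(a, b, c). a \<in> carrier F \<and> b \<in> carrier F \<and> c \<in> V\<^sub>0 \<and> pt x y z = pt a b c"
    using witt pt_closed[OF assms(2-4)] by (simp only: witt_decomposition_def)
  then obtain p where p: "\<And>a b c. a \<in> carrier F \<Longrightarrow> b \<in> carrier F \<Longrightarrow> c \<in> V\<^sub>0 \<Longrightarrow>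
      pt x y z = pt a b c \<Longrightarrow> (a, b, c) = p"
    by (elim ex1E) auto
  have "(x, y, z) = (x', y', z')"
    using p[of x y z] p[of x' y' z'] assms by simp
  thus "x = x'" "y = y'" "z = z'" by auto
qed

lemma Q_pt: "x \<in> carrier F \<Longrightarrow> y \<in> carrier F \<Longrightarrow> z \<in> V\<^sub>0 \<Longrightarrow> Q (pt x y z) = x \<otimes> y \<oplus> Q z"
  using witt unfolding witt_decomposition_def by blast

lemma pt_add:
  assumes "x \<in> carrier F" "y \<in> carrier F" "z \<in> V\<^sub>0" "x' \<in> carrier F" "y' \<in> carrier F" "z' \<in> V\<^sub>0"
  shows "pt x y z \<oplus>\<^bsub>V\<^esub> pt x' y' z' = pt (x \<oplus> x') (y \<oplus> y') (z \<oplus>\<^bsub>V\<^esub> z')"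
  using assms by (simp add: rn_pt_def smult_l_distr M.a_ac)

text \<open>Polarizing \<open>xy + Q z\<close> shows that \<open>e\<close> and \<open>f\<close> span
  a hyperbolic plane orthogonal to \<open>V\<^sub>0\<close>.\<close>

lemma two_qinner_pt:
  assumes "x \<in> carrier F" "y \<in> carrier F" "z \<in> V\<^sub>0" "x' \<in> carrier F" "y' \<in> carrier F" "z' \<in> V\<^sub>0"
  shows "[(2::nat)] \<cdot> B (pt x y z) (pt x' y' z') = x \<otimes> y' \<oplus> x' \<otimes> y \<oplus> [(2::nat)] \<cdot> B z z'"
proof -
  note c = assms(1,2,4,5)
  define b where "b = [(2::nat)] \<cdot> B z z'"
  have b: "b \<in> carrier F" using assms by (simp add: b_def)
  \<comment> \<open>Naming the values of \<open>Q\<close> and \<open>B\<close> turns them into atoms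
    for \<open>algebra\<close>.\<close>
  define Qz Qz' where "Qz = Q z" and "Qz' = Q z'"
  have q: "Qz \<in> carrier F" "Qz' \<in> carrier F" using assms by (simp_all add: Qz_def Qz'_def)
  have "[(2::nat)] \<cdot> B (pt x y z) (pt x' y' z')
      = ((x \<oplus> x') \<otimes> (y \<oplus> y') \<oplus> (Qz \<oplus> Qz' \<oplus> b)) \<ominus> (x \<otimes> y \<oplus> Qz) \<ominus> (x' \<otimes> y' \<oplus> Qz')"
    using assms two_qinner[OF pt_closed pt_closed, of x y z x' y' z'] Q_add[of z z']
    by (simp only: pt_add Q_pt V0_add V0_closed R.a_closed b_def Qz_def Qz'_def)
  also have "\<dots> = x \<otimes> y' \<oplus> x' \<otimes> y \<oplus> b"
    using c q b by algebra
  finally show ?thesis by (simp add: b_def)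
qed

section \<open>Coordinates in \<open>V\<^sub>0\<close> and duality by nondegeneracy\<close>

lemma lincomb_V0: "a \<in> {1..d-2} \<rightarrow> carrier F \<Longrightarrow> lincomb a \<in> V\<^sub>0"
  by (intro V0_finsum Pi_I V0_smult u_V0) (auto dest: Pi_mem)

lemma lincomb_inj:
  assumes "lincomb a = lincomb b" "a \<in> {1..d-2} \<rightarrow> carrier F" "b \<in> {1..d-2} \<rightarrow> carrier F"
    "j \<in> {1..d-2}"
  shows "a j = b j"
proof -
  \<comment> \<open>Uniqueness of coordinates is available only for extensional families, so both
    families are first restricted to the index set.\<close>
  have res: "lincomb (restrict c {1..d-2}) = lincomb c" if "c \<in> {1..d-2} \<rightarrow> carrier F" for c
    using that by (intro M.finsum_cong') (auto simp: u_V0)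
  have "\<exists>!c. c \<in> {1..d-2} \<rightarrow>\<^sub>E carrier F \<and> lincomb a = lincomb c"
    using basis lincomb_V0[OF assms(2)] unfolding rn_basis_def by blast
  moreover have "restrict a {1..d-2} \<in> {1..d-2} \<rightarrow>\<^sub>E carrier F" "restrict b {1..d-2} \<in> {1..d-2} \<rightarrow>\<^sub>E carrier F"
    using assms by auto
  moreover have "lincomb a = lincomb (restrict a {1..d-2})" "lincomb a = lincomb (restrict b {1..d-2})"
    using res assms by simp_all
  ultimately have "restrict a {1..d-2} = restrict b {1..d-2}" by blast
  from fun_cong[OF this, of j] show ?thesis using assms(4) by simp
qed

lemma lincomb_surj:
  assumes "z \<in> V\<^sub>0"
  obtains a where "a \<in> {1..d-2} \<rightarrow> carrier F" "z = lincomb a"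
proof -
  have "\<exists>!a. a \<in> {1..d-2} \<rightarrow>\<^sub>E carrier F \<and> z = lincomb a"
    using basis assms unfolding rn_basis_def by blast
  then obtain a where "a \<in> {1..d-2} \<rightarrow>\<^sub>E carrier F" "z = lincomb a" by blast
  thus ?thesis using that[of a] by (simp add: PiE_iff Pi_iff)
qed

lemma qinner_lincomb:
  assumes "v \<in> carrier V" "a \<in> {1..d-2} \<rightarrow> carrier F"
  shows "B v (lincomb a) = (\<Oplus> j\<in>{1..d-2}. a j \<otimes> B v (u j))"
proof -
  have "B v (lincomb a) = (\<Oplus> j\<in>{1..d-2}. B v (a j \<odot>\<^bsub>V\<^esub> u j))"
    using assms u_V0 by (intro qinner_finsum_right) auto
  also have "\<dots> = (\<Oplus> j\<in>{1..d-2}. a j \<otimes> B v (u j))"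
  proof (intro R.finsum_cong')
    show "B v (a j \<odot>\<^bsub>V\<^esub> u j) = a j \<otimes> B v (u j)" if "j \<in> {1..d-2}" for j
      using assms u_V0[OF that] that
      by (subst (1 2) qinner_sym) (auto simp: qinner_smult_left Pi_iff)
  qed (use assms u_V0 in auto)
  finally show ?thesis .
qed

text \<open>The difference \<open>z - z'\<close> is orthogonal to a basis, hence to all of
  \<open>V\<^sub>0\<close>, and nondegeneracy on \<open>V\<^sub>0\<close> makes it zero.\<close>

lemma eq_of_qinner_basis_eq:
  assumes "z \<in> V\<^sub>0" "z' \<in> V\<^sub>0" "\<And>j. j \<in> {1..d-2} \<Longrightarrow> B z (u j) = B z' (u j)"
  shows "z = z'"
proof -
  \<comment> \<open>Replacing the carrier of \<open>V\<close> leaves its addition unchanged, so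
    \<open>qinner\<close> takes the same values in the restricted module.\<close>
  have "qinner F (V\<lparr>carrier := V\<^sub>0\<rparr>) Q (z \<ominus>\<^bsub>V\<^esub> z') w = \<zero>" if "w \<in> V\<^sub>0" for w
  proof -
    obtain a where a: "a \<in> {1..d-2} \<rightarrow> carrier F" "w = lincomb a"
      using lincomb_surj \<open>w \<in> V\<^sub>0\<close> by blast
    have "B z w = B z' w"
      unfolding a(2) qinner_lincomb[OF V0_closed[OF assms(1)] a(1)]
        qinner_lincomb[OF V0_closed[OF assms(2)] a(1)]
      using assms a(1) u_V0 by (intro R.finsum_cong') (auto dest: Pi_mem)
    moreover have "B (z \<ominus>\<^bsub>V\<^esub> z') w = B z w \<ominus> B z' w"
      using assms(1,2) that qinner_smult_left[of "\<ominus> \<one>" z' w]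
      by (simp add: M.minus_eq R.minus_eq qinner_add_left smult_l_minus R.l_minus)
    ultimately show ?thesis using assms that by (simp add: qinner_def)
  qed
  moreover have "nondegenerate F (V\<lparr>carrier := V\<^sub>0\<rparr>) Q"
    using witt by (simp add: witt_decomposition_def)
  ultimately have "z \<ominus>\<^bsub>V\<^esub> z' = \<zero>\<^bsub>V\<^esub>"
    using V0_diff[OF assms(1,2)] unfolding nondegenerate_def by simp
  thus ?thesis using assms(1,2) M.minus_equality[of z "\<ominus>\<^bsub>V\<^esub> z'"] by (simp add: M.minus_eq)
qed

text \<open>Supplies the vector \<open>z\<close> for which the middle coefficients of
  \<open>\<Psi>\<close> take prescribed values.\<close>

lemma qinner_basis_surj:
  assumes "c \<in> {1..d-2} \<rightarrow> carrier F"
  obtains z where "z \<in> V\<^sub>0" "\<And>j. j \<in> {1..d-2} \<Longrightarrow> [(2::nat)] \<cdot> B z (u j) = c j"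
proof -
  let ?C = "{1..d-2} \<rightarrow>\<^sub>E carrier F"
  \<comment> \<open>In coordinates, \<open>T\<close> is multiplication by twice the Gram matrix of
    the basis.\<close>
  define T where "T a = (\<lambda>j\<in>{1..d-2}. [(2::nat)] \<cdot> B (lincomb a) (u j))" for a
  have L: "lincomb a \<in> V\<^sub>0" if "a \<in> ?C" for a
    using that by (intro lincomb_V0) auto
  have TC: "T a \<in> ?C" if "a \<in> ?C" for a
    using L[OF that] u_V0 by (auto simp: T_def)
  have "inj_on T ?C"
  proof (rule inj_onI)
    fix a b assume ab: "a \<in> ?C" "b \<in> ?C" "T a = T b"
    have "B (lincomb a) (u j) = B (lincomb b) (u j)" if "j \<in> {1..d-2}" for j
    proof (rule two_cancel)
      show "[(2::nat)] \<cdot> B (lincomb a) (u j) = [(2::nat)] \<cdot> B (lincomb b) (u j)"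
        using fun_cong[OF ab(3), of j] that by (simp add: T_def)
    qed (use L ab that u_V0 in auto)
    hence "lincomb a = lincomb b"
      using L ab by (intro eq_of_qinner_basis_eq) auto
    hence "a j = b j" if "j \<in> {1..d-2}" for j
      using lincomb_inj[OF _ _ _ that] ab(1,2) by blast
    thus "a = b" by (intro PiE_ext[OF ab(1,2)]) auto
  qed
  \<comment> \<open>Finiteness turns injectivity into surjectivity, which replaces a dimension count.\<close>
  moreover have "finite ?C" using finite_carrier by (intro finite_PiE) auto
  ultimately have "T ` ?C = ?C" using TC by (intro endo_inj_surj) auto
  moreover have "restrict c {1..d-2} \<in> ?C" using assms by auto
  ultimately have "restrict c {1..d-2} \<in> T ` ?C" by (simp only:)
  then obtain a where a: "a \<in> ?C" "restrict c {1..d-2} = T a" by blast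
  show ?thesis
  proof (rule that[OF L[OF a(1)]])
    show "[(2::nat)] \<cdot> B (lincomb a) (u j) = c j" if "j \<in> {1..d-2}" for j
      using fun_cong[OF a(2), of j] that by (simp add: T_def)
  qed
qed

section \<open>Centers and spheres\<close>

lemma zc_V0 [simp]: "t \<in> carrier F \<Longrightarrow> zc t \<in> V\<^sub>0"
  unfolding rn_z_def by (intro lincomb_V0) auto

lemma center_eq_pt:
  assumes "t \<in> carrier F"
  shows "center t = pt \<zero> (t [^] (d-1)) (zc t)"
  using assms by (simp add: rn_center_def rn_pt_def)

lemma center_closed [simp, intro]: "t \<in> carrier F \<Longrightarrow> center t \<in> carrier V"
  by (simp add: center_eq_pt)

lemma gamma_closed [simp, intro]: "\<gamma> \<in> carrier F"
  by (simp add: rn_gamma_def)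

lemma b_closed [simp, intro]: "t \<in> carrier F \<Longrightarrow> rn_b F d Q W t \<in> carrier F"
  by (simp add: rn_b_def)

lemma center_inj: "inj_on center (carrier F)"
proof (rule inj_onI)
  fix s t assume st: "s \<in> carrier F" "t \<in> carrier F" "center s = center t"
  have "zc s = zc t"
    using st pt_inj(3)[of \<zero> "s [^] (d-1)" "zc s" \<zero> "t [^] (d-1)" "zc t"]
    by (simp add: center_eq_pt)
  \<comment> \<open>The first basis coordinate of \<open>zc t\<close> is \<open>t\<close> itself; it
    is present because \<open>d - 2 \<ge> 1\<close>.\<close>
  hence "s [^] (1::nat) = t [^] (1::nat)"
    unfolding rn_z_def using st d_ge_3
    by (intro lincomb_inj[of "\<lambda>j. s [^] j" "\<lambda>j. t [^] j"]) auto
  thus "s = t" using st by simp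
qed

lemma sphere_inj: "inj_on sphere (carrier F)"
  using center_inj by (auto simp: inj_on_def rn_sphere_def)

section \<open>Coefficients and values of \<open>\<Psi>\<close>\<close>

abbreviation "lin_sum z \<equiv> (\<Oplus>\<^bsub>UP F\<^esub> j\<in>{1..d-2}. monom (UP F) ([(2::nat)] \<cdot> B z (u j)) j)"

lemma two_qinner_u_closed [simp]:
  "z \<in> V\<^sub>0 \<Longrightarrow> j \<in> {1..d-2} \<Longrightarrow> [(2::nat)] \<cdot> B z (u j) \<in> carrier F"
  using u_V0 by auto

lemma lin_sum_closed: "z \<in> V\<^sub>0 \<Longrightarrow> lin_sum z \<in> carrier (UP F)"
  by (intro U.P.finsum_closed Pi_I U.monom_closed two_qinner_u_closed)

lemma Psi_closed:
  "x \<in> carrier F \<Longrightarrow> y \<in> carrier F \<Longrightarrow> z \<in> V\<^sub>0 \<Longrightarrow> \<Psi> x y z \<in> carrier (UP F)"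
  unfolding rn_Psi_def
  by (intro U.P.a_closed lin_sum_closed U.monom_closed R.minus_closed R.a_closed) auto

lemma coeff_lin_sum:
  assumes "z \<in> V\<^sub>0"
  shows "coeff (UP F) (lin_sum z) n = (if n \<in> {1..d-2} then [(2::nat)] \<cdot> B z (u n) else \<zero>)"
proof -
  have "coeff (UP F) (lin_sum z) n
      = (\<Oplus> j\<in>{1..d-2}. coeff (UP F) (monom (UP F) ([(2::nat)] \<cdot> B z (u j)) j) n)"
    by (intro U.coeff_finsum Pi_I U.monom_closed two_qinner_u_closed assms) auto
  also have "\<dots> = (\<Oplus> j\<in>{1..d-2}. if n = j then [(2::nat)] \<cdot> B z (u j) else \<zero>)"
  proof (rule R.finsum_cong')
    fix j assume "j \<in> {1..d-2}"
    thus "coeff (UP F) (monom (UP F) ([(2::nat)] \<cdot> B z (u j)) j) n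
        = (if n = j then [(2::nat)] \<cdot> B z (u j) else \<zero>)"
      using U.coeff_monom[OF two_qinner_u_closed[OF assms]] by auto
  qed (use two_qinner_u_closed[OF assms] in auto)
  also have "\<dots> = (if n \<in> {1..d-2} then [(2::nat)] \<cdot> B z (u n) else \<zero>)"
  proof (cases "n \<in> {1..d-2}")
    case True
    thus ?thesis using two_qinner_u_closed[OF assms]
      by (subst R.finsum_singleton) auto
  next
    case False
    hence "(\<Oplus> j\<in>{1..d-2}. if n = j then [(2::nat)] \<cdot> B z (u j) else \<zero>) = (\<Oplus> j\<in>{1..d-2}. \<zero>)"
      by (intro R.finsum_cong') auto
    thus ?thesis unfolding if_not_P[OF False] by simp
  qed
  finally show ?thesis .
qed

text \<open>For \<open>d \<ge> 3\<close> the exponents \<open>d\<close>, \<open>d - 1\<close>,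
  \<open>1..d-2\<close> and \<open>0\<close> are distinct, so at most one summand contributes to
  each coefficient.\<close>

lemma coeff_Psi:
  assumes "x \<in> carrier F" "y \<in> carrier F" "z \<in> V\<^sub>0"
  shows "coeff (UP F) (\<Psi> x y z) n =
    (if n = d then \<one> else if n = d - 1 then x \<oplus> \<gamma>
     else if n \<in> {1..d-2} then [(2::nat)] \<cdot> B z (u n)
     else if n = 0 then \<kappa> \<ominus> Q (pt x y z) else \<zero>)"
proof -
  have "coeff (UP F) (\<Psi> x y z) n =
      (if d = n then \<one> else \<zero>) \<oplus> (if d - 1 = n then x \<oplus> \<gamma> else \<zero>) \<oplus>
      (if n \<in> {1..d-2} then [(2::nat)] \<cdot> B z (u n) else \<zero>) \<oplus> (if 0 = n then \<kappa> \<ominus> Q (pt x y z) else \<zero>)"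
    using assms lin_sum_closed[OF assms(3)] coeff_lin_sum[OF assms(3)]
    unfolding rn_Psi_def by (simp del: atLeastAtMost_iff One_nat_def)
  also have "\<dots> = (if n = d then \<one> else if n = d - 1 then x \<oplus> \<gamma>
     else if n \<in> {1..d-2} then [(2::nat)] \<cdot> B z (u n)
     else if n = 0 then \<kappa> \<ominus> Q (pt x y z) else \<zero>)"
    using assms two_qinner_u_closed[OF assms(3)] d_ge_3 by auto
  finally show ?thesis .
qed

text \<open>The vector \<open>zc t\<close> lies on the moment curve, so pairing with it evaluates at
  \<open>t\<close> the polynomial whose coefficients are the pairings with the basis.\<close>

lemma two_qinner_zc:
  assumes "t \<in> carrier F" "z \<in> V\<^sub>0"
  shows "[(2::nat)] \<cdot> B z (zc t) = (\<Oplus> j\<in>{1..d-2}. ([(2::nat)] \<cdot> B z (u j)) \<otimes> t [^] j)"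
proof -
  have c: "B z (u j) \<in> carrier F" if "j \<in> {1..d-2}" for j using that assms u_V0 by auto
  have "[(2::nat)] \<cdot> B z (zc t) = [(2::nat)] \<cdot> (\<Oplus> j\<in>{1..d-2}. t [^] j \<otimes> B z (u j))"
    unfolding rn_z_def using assms by (subst qinner_lincomb) auto
  also have "\<dots> = (\<Oplus> j\<in>{1..d-2}. [(2::nat)] \<cdot> (t [^] j \<otimes> B z (u j)))"
    using assms c by (intro two_finsum) auto
  also have "\<dots> = (\<Oplus> j\<in>{1..d-2}. ([(2::nat)] \<cdot> B z (u j)) \<otimes> t [^] j)"
  proof (rule R.finsum_cong')
    fix j assume "j \<in> {1..d-2}"
    thus "[(2::nat)] \<cdot> (t [^] j \<otimes> B z (u j)) = ([(2::nat)] \<cdot> B z (u j)) \<otimes> t [^] j"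
      using c[of j] assms R.m_comm[of "t [^] j" "B z (u j)"]
      by (simp add: add_pow_ldistr)
  qed (use c assms in auto)
  finally show ?thesis .
qed

lemma eval_Psi:
  assumes "x \<in> carrier F" "y \<in> carrier F" "z \<in> V\<^sub>0" "t \<in> carrier F"
  shows "eval F F id t (\<Psi> x y z) =
    t [^] d \<oplus> (x \<oplus> \<gamma>) \<otimes> t [^] (d-1) \<oplus> [(2::nat)] \<cdot> B z (zc t) \<oplus> (\<kappa> \<ominus> Q (pt x y z))"
proof -
  interpret E: ring_hom_cring "UP F" F "eval F F id t"
    by (rule U.ring_hom_cring_eval[OF assms(4)])
  have "eval F F id t (lin_sum z)
      = (\<Oplus> j\<in>{1..d-2}. eval F F id t (monom (UP F) ([(2::nat)] \<cdot> B z (u j)) j))"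
    by (subst E.hom_finsum)
      (auto simp: comp_def simp del: atLeastAtMost_iff One_nat_def intro!: U.monom_closed two_qinner_u_closed assms)
  also have "\<dots> = [(2::nat)] \<cdot> B z (zc t)"
    unfolding two_qinner_zc[OF assms(4,3)] using assms(4) two_qinner_u_closed[OF assms(3)]
    by (intro R.finsum_cong') (auto simp: U.eval_monom_id simp del: atLeastAtMost_iff One_nat_def)
  finally show ?thesis
    unfolding rn_Psi_def using assms lin_sum_closed[OF assms(3)]
    by (simp add: U.eval_monom_id R.l_distr del: atLeastAtMost_iff One_nat_def)
qed

text \<open>The value \<open>\<Psi>(p)(t)\<close> is the radius \<open>Q(c) + b\<close> minus
  \<open>Q(p - c)\<close>, where \<open>c\<close> is the center. Since \<open>c\<close> has no
  \<open>e\<close>-component, twice its pairing with \<open>p\<close> is \<open>x t^(d-1)\<close>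
  plus twice \<open>B z (zc t)\<close>, and \<open>Q(c)\<close> cancels.\<close>

lemma pt_in_sphere_iff:
  assumes "x \<in> carrier F" "y \<in> carrier F" "z \<in> V\<^sub>0" "t \<in> carrier F"
  shows "pt x y z \<in> sphere_points V Q (sphere t) \<longleftrightarrow> eval F F id t (\<Psi> x y z) = \<zero>"
proof -
  define q c b s k where defs: "q = Q (pt x y z)" "c = Q (center t)" "b = rn_b F d Q W t"
    "s = [(2::nat)] \<cdot> B z (zc t)" "k = t [^] (d-1)"
  define td where "td = t [^] d"
  note assms [simp]
  have cl: "q \<in> carrier F" "c \<in> carrier F" "b \<in> carrier F" "s \<in> carrier F" "k \<in> carrier F"
      "td \<in> carrier F" "\<gamma> \<in> carrier F" "\<kappa> \<in> carrier F" "x \<in> carrier F"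
    by (simp_all add: defs td_def)
  have b: "b = td \<oplus> \<gamma> \<otimes> k \<oplus> \<kappa>" by (simp add: defs td_def rn_b_def)
  have "[(2::nat)] \<cdot> B (pt x y z) (center t) = x \<otimes> k \<oplus> s"
    by (simp add: center_eq_pt two_qinner_pt defs)
  hence Q: "Q (pt x y z \<ominus>\<^bsub>V\<^esub> center t) = q \<oplus> c \<ominus> (x \<otimes> k \<oplus> s)"
    by (simp add: Q_diff defs)
  have ev: "eval F F id t (\<Psi> x y z) = td \<oplus> (x \<oplus> \<gamma>) \<otimes> k \<oplus> s \<oplus> (\<kappa> \<ominus> q)"
    by (simp add: eval_Psi defs td_def)
  \<comment> \<open>The key identity: value of \<open>\<Psi>\<close> equals radius minus
    \<open>Q(p - c)\<close>.\<close>
  have "td \<oplus> (x \<oplus> \<gamma>) \<otimes> k \<oplus> s \<oplus> (\<kappa> \<ominus> q) = (c \<oplus> b) \<ominus> (q \<oplus> c \<ominus> (x \<otimes> k \<oplus> s))"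
    unfolding b using cl by algebra
  hence "eval F F id t (\<Psi> x y z) = (c \<oplus> b) \<ominus> (q \<oplus> c \<ominus> (x \<otimes> k \<oplus> s))"
    using ev by simp
  moreover have "(c \<oplus> b) \<ominus> (q \<oplus> c \<ominus> (x \<otimes> k \<oplus> s)) = \<zero> \<longleftrightarrow> c \<oplus> b = q \<oplus> c \<ominus> (x \<otimes> k \<oplus> s)"
    using cl by simp
  moreover have "pt x y z \<in> sphere_points V Q (sphere t) \<longleftrightarrow> q \<oplus> c \<ominus> (x \<otimes> k \<oplus> s) = c \<oplus> b"
    by (simp add: sphere_points_def rn_sphere_def Q flip: defs)
  ultimately show ?thesis by auto
qed

section \<open>Bijectivity of \<open>\<Psi>\<close> and the points \<open>p\<^sub>A\<close>\<close>

text \<open>The order of comparison matters: \<open>y\<close> enters only through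
  \<open>xy + Q z\<close> in the constant coefficient, so \<open>x\<close> and \<open>z\<close> are
  identified first and \<open>x\<close> is then cancelled.\<close>

lemma Psi_inj:
  assumes "\<Psi> x y z = \<Psi> x' y' z'" "x \<in> carrier F - {\<zero>}" "y \<in> carrier F" "z \<in> V\<^sub>0"
    "x' \<in> carrier F" "y' \<in> carrier F" "z' \<in> V\<^sub>0"
  shows "x = x'" "y = y'" "z = z'"
proof -
  have cl [simp]: "x \<in> carrier F" "x \<noteq> \<zero>" using assms by auto
  note [simp] = assms(3-7)
  note cf = coeff_Psi[OF cl(1) assms(3,4)] coeff_Psi[OF assms(5-7)]
  have eq: "coeff (UP F) (\<Psi> x y z) n = coeff (UP F) (\<Psi> x' y' z') n" for n
    using assms(1) by simp
  have "d - 1 \<noteq> d" using d_ge_3 by simp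
  hence "x \<oplus> \<gamma> = x' \<oplus> \<gamma>" using eq[of "d-1"] by (simp add: cf)
  thus x: "x = x'" by simp
  show z: "z = z'"
  proof (rule eq_of_qinner_basis_eq)
    show "B z (u j) = B z' (u j)" if j: "j \<in> {1..d-2}" for j
    proof (rule two_cancel)
      have "j \<noteq> d" "j \<noteq> d - 1" using j d_ge_3 by auto
      thus "[(2::nat)] \<cdot> B z (u j) = [(2::nat)] \<cdot> B z' (u j)"
        using eq[of j] j unfolding cf by (simp only: if_False if_True)
    qed (use u_V0[OF j] in auto)
  qed auto
  \<comment> \<open>The map taking \<open>a\<close> to \<open>\<kappa> - a\<close> is an involution,
    so it can be removed from both sides.\<close>
  have sub: "\<kappa> \<ominus> (\<kappa> \<ominus> a) = a" if "a \<in> carrier F" for a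
    using that kappa_closed by algebra
  have "\<kappa> \<ominus> Q (pt x y z) = \<kappa> \<ominus> Q (pt x' y' z')"
    using eq[of 0] d_ge_3 by (simp add: cf)
  hence "\<kappa> \<ominus> (\<kappa> \<ominus> Q (pt x y z)) = \<kappa> \<ominus> (\<kappa> \<ominus> Q (pt x' y' z'))"
    by (simp only:)
  moreover have "Q (pt x y z) \<in> carrier F" "Q (pt x' y' z') \<in> carrier F" by auto
  ultimately have "Q (pt x y z) = Q (pt x' y' z')" by (simp only: sub)
  hence "x \<otimes> y = x \<otimes> y'" using x z by (simp add: Q_pt)
  thus "y = y'" by (simp add: F.m_lcancel)
qed

text \<open>The coefficients of the product are matched one by one. By Vieta, the sum excluded in
  \<open>rn_sets\<close> is exactly the case \<open>x = \<zero>\<close>, in which the constant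
  coefficient would not depend on \<open>y\<close>.\<close>

lemma Psi_surj:
  assumes A: "A \<in> rn_sets F d Q W"
  obtains x y z where "x \<in> carrier F - {\<zero>}" "y \<in> carrier F" "z \<in> V\<^sub>0" "\<Psi> x y z = U.lin_prod A"
proof -
  have A: "A \<subseteq> carrier F" "card A = d" and ne: "\<ominus> (\<Oplus>a\<in>A. a) \<noteq> \<gamma>"
    using assms by (auto simp: rn_sets_def)
  have fA: "finite A" using A(1) finite_carrier finite_subset by auto
  define c where "c = coeff (UP F) (U.lin_prod A)"
  have pc: "U.lin_prod A \<in> carrier (UP F)" by (rule U.lin_prod_closed[OF A(1)])
  have c [simp]: "c n \<in> carrier F" for n unfolding c_def using pc by (rule U.coeff_closed)
  have cA: "n > d \<Longrightarrow> c n = \<zero>" "c d = \<one>" "c (d - 1) = \<ominus> (\<Oplus> a\<in>A. a)" for n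
    using U.coeff_lin_prod[OF fA A(1)] A(2) d_ge_3 unfolding c_def by auto
  define x where "x = c (d - 1) \<ominus> \<gamma>"
  have x: "x \<in> carrier F - {\<zero>}" using ne c[of "d-1"] unfolding x_def cA(3) by simp
  hence xU: "x \<in> Units F" by (simp add: F.field_Units)
  obtain z where z: "z \<in> V\<^sub>0" "\<And>j. j \<in> {1..d-2} \<Longrightarrow> [(2::nat)] \<cdot> B z (u j) = c j"
    using qinner_basis_surj[of c] by auto
  \<comment> \<open>This \<open>y\<close> solves \<open>\<kappa> - (xy + Q z) = c 0\<close>.\<close>
  define y where "y = inv x \<otimes> (\<kappa> \<ominus> c 0 \<ominus> Q z)"
  have y: "y \<in> carrier F" using xU z by (simp add: y_def)
  have "x \<otimes> y = \<kappa> \<ominus> c 0 \<ominus> Q z"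
    using xU z x by (simp add: y_def flip: R.m_assoc)
  hence Q: "Q (pt x y z) = \<kappa> \<ominus> c 0 \<ominus> Q z \<oplus> Q z" using x y z by (simp add: Q_pt)
  have Q0: "\<kappa> \<ominus> Q (pt x y z) = c 0"
  proof -
    have "\<kappa> \<in> carrier F" "c 0 \<in> carrier F" "Q z \<in> carrier F" using z by auto
    thus ?thesis unfolding Q by algebra
  qed
  have xg: "x \<oplus> \<gamma> = c (d - 1)"
    using c[of "d-1"] gamma_closed unfolding x_def by algebra
  have "\<Psi> x y z = U.lin_prod A"
  proof (rule U.up_eqI)
    fix n
    have "n = d \<or> n = d - 1 \<or> n \<in> {1..d-2} \<or> n = 0 \<or> n > d" by auto
    thus "coeff (UP F) (\<Psi> x y z) n = coeff (UP F) (U.lin_prod A) n"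
      unfolding c_def[symmetric] coeff_Psi[OF DiffD1[OF x] y z(1)]
      using z(2) cA xg Q0 d_ge_3 by (auto simp del: atLeastAtMost_iff)
  qed (use Psi_closed x y z pc in auto)
  thus ?thesis using that x y z by blast
qed

text \<open>Unfolds the definite description in \<open>rn_point\<close>: \<open>Psi_surj\<close>
  gives existence and \<open>Psi_inj\<close> uniqueness.\<close>

lemma point_eq:
  assumes "A \<in> rn_sets F d Q W"
  obtains x y z where "x \<in> carrier F - {\<zero>}" "y \<in> carrier F" "z \<in> V\<^sub>0" "\<Psi> x y z = U.lin_prod A"
    "point A = pt x y z"
proof -
  obtain x y z where xyz: "x \<in> carrier F - {\<zero>}" "y \<in> carrier F" "z \<in> V\<^sub>0" "\<Psi> x y z = U.lin_prod A"
    using Psi_surj[OF assms] by blast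
  have "point A = pt x y z"
    unfolding rn_point_def
  proof (rule the_equality)
    show "\<exists>x'\<in>carrier F - {\<zero>}. \<exists>y'\<in>carrier F. \<exists>z'\<in>V\<^sub>0. pt x y z = pt x' y' z' \<and> \<Psi> x' y' z' = U.lin_prod A"
      using xyz by blast
    fix p assume "\<exists>x'\<in>carrier F - {\<zero>}. \<exists>y'\<in>carrier F. \<exists>z'\<in>V\<^sub>0. p = pt x' y' z' \<and> \<Psi> x' y' z' = U.lin_prod A"
    then obtain x' y' z' where *: "x' \<in> carrier F" "y' \<in> carrier F" "z' \<in> V\<^sub>0" "p = pt x' y' z'"
      "\<Psi> x' y' z' = U.lin_prod A" by blast
    have "\<Psi> x y z = \<Psi> x' y' z'" using xyz(4) *(5) by simp
    from Psi_inj[OF this xyz(1-3) *(1-3)] show "p = pt x y z" using *(4) by simp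
  qed
  thus ?thesis using that xyz by blast
qed

lemma point_in_sphere_iff:
  assumes "A \<in> rn_sets F d Q W" "t \<in> carrier F"
  shows "point A \<in> sphere_points V Q (sphere t) \<longleftrightarrow> t \<in> A"
proof -
  obtain x y z where *: "x \<in> carrier F - {\<zero>}" "y \<in> carrier F" "z \<in> V\<^sub>0" "\<Psi> x y z = U.lin_prod A"
    "point A = pt x y z" using point_eq[OF assms(1)] by blast
  have A: "A \<subseteq> carrier F" "finite A"
    using assms(1) finite_carrier by (auto simp: rn_sets_def intro: finite_subset)
  have "point A \<in> sphere_points V Q (sphere t) \<longleftrightarrow> eval F F id t (\<Psi> x y z) = \<zero>"
    unfolding *(5) using *(1-3) assms(2) by (intro pt_in_sphere_iff) auto
  also have "\<dots> \<longleftrightarrow> t \<in> A"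
    unfolding *(4) by (rule U.eval_lin_prod_eq_zero[OF A(2,1) assms(2)])
  finally show ?thesis .
qed

text \<open>A set \<open>A\<close> is recovered from its point as the set of labels of the spheres
  through that point.\<close>

lemma point_inj: "inj_on point (rn_sets F d Q W)"
proof (rule inj_onI)
  fix A A' assume A: "A \<in> rn_sets F d Q W" "A' \<in> rn_sets F d Q W" "point A = point A'"
  have "t \<in> A \<longleftrightarrow> t \<in> A'" if "t \<in> carrier F" for t
    using point_in_sphere_iff[OF A(1) that] point_in_sphere_iff[OF A(2) that] A(3) by simp
  moreover have "A \<subseteq> carrier F" "A' \<subseteq> carrier F" using A by (auto simp: rn_sets_def)
  ultimately show "A = A'" by blast
qed

end

subsection \<open>Counting sets with prescribed sum\<close>

text \<open>Count pairs \<open>(A, a)\<close> with \<open>a \<in> A\<close> in two ways. Sending a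
  pair to \<open>A - {a}\<close> is injective because the prescribed sum forces the removed
  element.\<close>

lemma (in abelian_group) card_subsets_with_sum_le:
  assumes fin: "finite (carrier G)" and k: "k > 0"
  shows "k * card {A. A \<subseteq> carrier G \<and> card A = k \<and> (\<Oplus>a\<in>A. a) = s}
    \<le> card (carrier G) choose (k - 1)"
proof -
  let ?S = "{A. A \<subseteq> carrier G \<and> card A = k \<and> (\<Oplus>a\<in>A. a) = s}"
  let ?T = "{B. B \<subseteq> carrier G \<and> card B = k - 1}"
  have finS: "finite ?S" by (rule finite_subset[of _ "Pow (carrier G)"]) (use fin in auto)
  have finT: "finite ?T" by (rule finite_subset[of _ "Pow (carrier G)"]) (use fin in auto)
  have "(\<lambda>(A, a). A - {a}) ` (SIGMA A:?S. A) \<subseteq> ?T"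
    using fin by (auto simp: card_Diff_singleton)
  moreover have "inj_on (\<lambda>(A, a). A - {a}) (SIGMA A:?S. A)"
  proof (rule inj_onI, clarify)
    fix A a A' a'
    assume A: "A \<subseteq> carrier G" "A' \<subseteq> carrier G" "a \<in> A" "a' \<in> A'" "A - {a} = A' - {a'}"
      and s: "(\<Oplus>a\<in>A'. a) = (\<Oplus>a\<in>A. a)"
    have sum: "(\<Oplus>b\<in>C. b) = c \<oplus> (\<Oplus>b\<in>C - {c}. b)" if "C \<subseteq> carrier G" "c \<in> C" for C c
    proof -
      have "finite (C - {c})" using that(1) fin finite_subset by blast
      hence "(\<Oplus>b\<in>insert c (C - {c}). b) = c \<oplus> (\<Oplus>b\<in>C - {c}. b)"
        using that by (intro finsum_insert) auto
      thus ?thesis using that(2) by (simp add: insert_absorb)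
    qed
    have "(\<Oplus>b\<in>A - {a}. b) \<in> carrier G" using A by (intro finsum_closed) auto
    moreover have "a \<oplus> (\<Oplus>b\<in>A - {a}. b) = a' \<oplus> (\<Oplus>b\<in>A - {a}. b)"
      using sum[OF A(1,3)] sum[OF A(2,4)] s A(5) by simp
    ultimately have a: "a = a'" using A by (subst (asm) add.right_cancel) auto
    thus "A = A' \<and> a = a'" using A by blast
  qed
  ultimately have "card (SIGMA A:?S. A) \<le> card ?T" using card_inj_on_le[OF _ _ finT] by blast
  moreover have "card (SIGMA A:?S. A) = (\<Sum>A\<in>?S. card A)"
    using finS fin by (intro card_SigmaI) (auto intro: finite_subset)
  moreover have "(\<Sum>A\<in>?S. card A) = k * card ?S" by simp
  moreover have "card ?T = card (carrier G) choose (k - 1)" by (rule n_subsets[OF fin])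
  ultimately show ?thesis by (simp add: mult.commute)
qed

text \<open>For \<open>n \<ge> k\<close> the right side is the falling factorial, whose
  \<open>k\<close> factors are all at least \<open>n - k\<close>; for \<open>n < k\<close> truncated
  subtraction makes the left side zero.\<close>

lemma fact_times_binomial_ge: "(n - k) ^ k \<le> fact k * (n choose k)"
proof (induction k)
  case (Suc k)
  have "(n - Suc k) ^ Suc k \<le> (n - k) ^ Suc k" by (intro power_mono) auto
  also have "\<dots> \<le> (n - k) * (fact k * (n choose k))" using Suc by simp
  also have "\<dots> = fact k * ((n - k) * (n choose k))" by simp
  also have "(n - k) * (n choose k) = Suc k * (n choose Suc k)"
    by (simp only: binomial_absorb_comp binomial_absorption)
  finally show ?case by (simp add: algebra_simps)
qed simp

text \<open>The asymptotic comparison behind the upper end of the moderate range. Growth decides it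
  for \<open>k \<ge> 4\<close>; for \<open>k = 3\<close> the degrees agree and the leading
  coefficient must exceed 1.\<close>

lemma eventually_cube_le:
  fixes c a :: real
  assumes "c > 0" and "k \<ge> 4 \<or> k = 3 \<and> c > 1"
  shows "eventually (\<lambda>n. real n ^ 3 \<le> c * (real n - a) ^ k) sequentially"
proof -
  have "eventually (\<lambda>x. x ^ 3 \<le> c * (x - a) ^ k) at_top"
  proof (cases "k = 3")
    case True
    hence "c > 1" using assms by auto
    hence "eventually (\<lambda>x. x ^ 3 \<le> c * (x - a) ^ 3) at_top" by real_asymp
    thus ?thesis using True by simp
  next
    case False
    have "eventually (\<lambda>x. x ^ 3 \<le> c * (x - a) ^ 4) at_top" using assms(1) by real_asymp
    \<comment> \<open>From here on the base \<open>x - a\<close> is at least 1, so its powers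
      increase and exponent 4 is the worst case.\<close>
    moreover have "eventually (\<lambda>x. x \<ge> a + 1) at_top" by (rule eventually_ge_at_top)
    ultimately show ?thesis
    proof eventually_elim
      case (elim x)
      have "(x - a) ^ 4 \<le> (x - a) ^ k" using elim False assms by (intro power_increasing) auto
      hence "c * (x - a) ^ 4 \<le> c * (x - a) ^ k" using assms(1) by (intro mult_left_mono) auto
      thus ?case using elim by linarith
    qed
  qed
  thus ?thesis by (rule eventually_compose_filterlim[OF _ filterlim_real_sequentially])
qed

subsection \<open>Incidence counts and density\<close>

context rn_construction
begin

lemma finite_rn_sets: "finite (rn_sets F d Q W)"
  by (rule finite_subset[of _ "Pow (carrier F)"]) (use finite_carrier in \<open>auto simp: rn_sets_def\<close>)

text \<open>With \<open>k = d - 1\<close>, \<open>d\<close> times the number of all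
  \<open>d\<close>-sets is \<open>(q - k) (q choose k)\<close>. The sets with the excluded sum cost
  at most one further \<open>q choose k\<close>, which lowers the factor \<open>q - k\<close> to
  \<open>q - d\<close>.\<close>

lemma card_rn_sets_ge: "(card (carrier F) - d) ^ d \<le> fact d * card (rn_sets F d Q W)"
proof -
  define q where "q = card (carrier F)"
  let ?T = "{A. A \<subseteq> carrier F \<and> card A = d}"
  let ?N = "{A. A \<subseteq> carrier F \<and> card A = d \<and> (\<Oplus>a\<in>A. a) = \<ominus> \<gamma>}"
  obtain k where d: "d = Suc k" using d_ge_3 by (cases d) auto
  have "?T \<subseteq> rn_sets F d Q W \<union> ?N"
  proof
    fix A assume A: "A \<in> ?T"
    hence "(\<Oplus>a\<in>A. a) \<in> carrier F" by (intro R.finsum_closed) auto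
    hence "\<ominus> (\<Oplus>a\<in>A. a) = \<gamma> \<Longrightarrow> (\<Oplus>a\<in>A. a) = \<ominus> \<gamma>" by (metis R.minus_minus)
    thus "A \<in> rn_sets F d Q W \<union> ?N" using A by (auto simp: rn_sets_def)
  qed
  moreover have "finite ?N"
    by (rule finite_subset[of _ "Pow (carrier F)"]) (use finite_carrier in auto)
  ultimately have "card ?T \<le> card (rn_sets F d Q W \<union> ?N)"
    using finite_rn_sets by (intro card_mono) auto
  also have "\<dots> \<le> card (rn_sets F d Q W) + card ?N" by (rule card_Un_le)
  finally have "q choose d \<le> card (rn_sets F d Q W) + card ?N"
    using n_subsets[OF finite_carrier] by (simp add: q_def)
  hence "d * (q choose d) \<le> d * (card (rn_sets F d Q W) + card ?N)"
    by (rule mult_le_mono2)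
  hence "d * (q choose d) \<le> d * card (rn_sets F d Q W) + d * card ?N"
    by (simp only: add_mult_distrib2)
  moreover have "d * card ?N \<le> q choose k"
    using R.card_subsets_with_sum_le[OF finite_carrier, of d] d by (simp add: q_def)
  moreover have "d * (q choose d) = (q - k) * (q choose k)"
    unfolding d by (simp only: binomial_absorb_comp binomial_absorption)
  ultimately have "(q - k) * (q choose k) - (q choose k) \<le> d * card (rn_sets F d Q W)" by linarith
  hence *: "(q - d) * (q choose k) \<le> d * card (rn_sets F d Q W)"
    by (simp add: d diff_mult_distrib)
  \<comment> \<open>One factor \<open>q - d\<close> is kept and the other \<open>k\<close> are
    enlarged to \<open>q - k\<close>, to fit the binomial bound.\<close>
  have "(q - d) ^ d \<le> (q - d) * (q - k) ^ k"
    by (simp add: d power_mono)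
  also have "\<dots> \<le> (q - d) * (fact k * (q choose k))"
    by (intro mult_le_mono2 fact_times_binomial_ge)
  also have "\<dots> \<le> fact k * (d * card (rn_sets F d Q W))"
    using mult_le_mono2[OF *, of "fact k"] by (simp add: mult_ac)
  finally show ?thesis by (simp add: d q_def algebra_simps)
qed

lemma card_carrier_pos: "0 < card (carrier F)"
  using finite_carrier by (auto simp: card_gt_0_iff)

lemma card_rn_spheres: "card (rn_spheres F d Q W) = card (carrier F)"
  unfolding rn_spheres_def by (rule card_image[OF sphere_inj])

lemma card_le_power:
  assumes "G \<subseteq> rn_sets F d Q W"
  shows "card G \<le> card (carrier F) ^ d"
proof -
  have "card G \<le> card {A. A \<subseteq> carrier F \<and> card A = d}"
    by (rule card_mono[OF finite_subset[of _ "Pow (carrier F)"]])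
      (use assms finite_carrier in \<open>auto simp: rn_sets_def\<close>)
  also have "\<dots> = card (carrier F) choose d" by (rule n_subsets[OF finite_carrier])
  also have "\<dots> \<le> card (carrier F) ^ d"
    by (cases "d \<le> card (carrier F)") (simp_all add: binomial_le_pow binomial_eq_0)
  finally show ?thesis .
qed

context
  fixes G assumes G: "G \<subseteq> rn_sets F d Q W"
begin

lemma card_rn_points: "card (rn_points F d Q W G) = card G"
  unfolding rn_points_def by (rule card_image[OF inj_on_subset[OF point_inj G]])

lemma incidence_graph_rn:
  "incidence_graph V Q (rn_points F d Q W G) (rn_spheres F d Q W) =
    map_prod point sphere ` {(A, t). A \<in> G \<and> t \<in> carrier F \<and> t \<in> A}"
  (is "?L = ?R")
proof (intro subset_antisym subsetI)
  fix p assume "p \<in> ?L"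
  then obtain A t where *: "p = (point A, sphere t)" "A \<in> G" "t \<in> carrier F"
    "point A \<in> sphere_points V Q (sphere t)"
    by (auto simp: incidence_graph_def rn_points_def rn_spheres_def)
  hence "t \<in> A" using point_in_sphere_iff[of A t] G by blast
  thus "p \<in> ?R" using * by (intro image_eqI[of _ _ "(A, t)"]) auto
next
  fix p assume "p \<in> ?R"
  thus "p \<in> ?L" using point_in_sphere_iff G
    by (auto simp: incidence_graph_def rn_points_def rn_spheres_def)
qed

lemma incidences_rn: "incidences V Q (rn_points F d Q W G) (rn_spheres F d Q W) = d * card G"
proof -
  let ?M = "{(A, t). A \<in> G \<and> t \<in> carrier F \<and> t \<in> A}"
  have "inj_on (map_prod point sphere) (rn_sets F d Q W \<times> carrier F)"
    by (rule map_prod_inj_on[OF point_inj sphere_inj])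
  moreover have "?M \<subseteq> rn_sets F d Q W \<times> carrier F" using G by auto
  ultimately have "incidences V Q (rn_points F d Q W G) (rn_spheres F d Q W) = card ?M"
    unfolding incidences_def incidence_graph_rn by (intro card_image) (rule inj_on_subset)
  also have "?M = (SIGMA A:G. A)" using G by (auto simp: rn_sets_def)
  also have "card \<dots> = (\<Sum>A\<in>G. card A)"
    using G finite_carrier finite_rn_sets
    by (intro card_SigmaI) (auto simp: rn_sets_def intro: finite_subset)
  also have "\<dots> = d * card G" using G by (simp add: rn_sets_def subset_iff)
  finally show ?thesis .
qed

text \<open>There are exactly \<open>q\<close> spheres, so the expected count
  \<open>|P||S|/q\<close> is \<open>card G\<close>, to be subtracted from
  \<open>d * card G\<close>.\<close>

lemma discrepancy_rn:
  "discrepancy F V Q (rn_points F d Q W G) (rn_spheres F d Q W) = (real d - 1) * real (card G)"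
  using card_carrier_pos
  by (simp add: discrepancy_def incidences_rn card_rn_points card_rn_spheres algebra_simps)

lemma rn_K_eq: "rn_K F d Q W G = (real d - 1) * sqrt (real (card G)) / real (card (carrier F)) powr (real d / 2)"
proof -
  define q m where "q = real (card (carrier F))" and "m = real (card G)"
  have q: "q > 0" using card_carrier_pos by (simp add: q_def)
  have "q powr ((real d - 1) / 2) * sqrt (m * q) = sqrt m * (q powr ((real d - 1) / 2) * q powr (1 / 2))"
    using q by (simp add: real_sqrt_mult powr_half_sqrt)
  also have "q powr ((real d - 1) / 2) * q powr (1 / 2) = q powr (real d / 2)"
    by (simp add: field_simps flip: powr_add add_divide_distrib)
  finally have "rn_K F d Q W G = (real d - 1) * m / (sqrt m * q powr (real d / 2))"
    by (simp add: rn_K_def K_const_def discrepancy_rn card_rn_points card_rn_spheres q_def m_def)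
  also have "\<dots> = (real d - 1) * (m / sqrt m) / q powr (real d / 2)" by simp
  \<comment> \<open>This includes \<open>m = 0\<close>, where both sides are 0 because division by
    zero gives 0.\<close>
  also have "m / sqrt m = sqrt m" by (simp add: real_div_sqrt m_def)
  finally show ?thesis by (simp add: q_def m_def)
qed

text \<open>Shows \<open>K\<close> as a function of the density \<open>m / q^d\<close>, the form in
  which it is estimated.\<close>

lemma rn_K_eq': "rn_K F d Q W G = (real d - 1) * sqrt (real (card G) / real (card (carrier F)) ^ d)"
proof -
  have "real (card (carrier F)) powr (real d / 2) = sqrt (real (card (carrier F)) ^ d)"
    using card_carrier_pos by (simp add: powr_half_sqrt powr_realpow flip: powr_powr[of _ "real d" "1/2", simplified])
  thus ?thesis by (simp add: rn_K_eq real_sqrt_divide)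
qed

lemma rn_K_nonneg: "0 \<le> rn_K F d Q W G"
  using d_ge_3 by (simp add: rn_K_eq)

lemma rn_K_square: "(rn_K F d Q W G)\<^sup>2 * real (card (carrier F)) ^ d = (real d - 1)\<^sup>2 * real (card G)"
  using card_carrier_pos by (simp add: rn_K_eq' power_mult_distrib)

end

section \<open>Bounds on \<open>K\<close> and the moderate range\<close>

lemma density_le:
  assumes "G \<subseteq> rn_sets F d Q W" "real (card G) \<ge> \<rho> * real (card (rn_sets F d Q W))" "\<rho> > 0"
    "card (carrier F) \<ge> d"
  shows "\<rho> / fact d * (real (card (carrier F)) - real d) ^ d \<le> real (card G)"
proof -
  have "real ((card (carrier F) - d) ^ d) \<le> real (fact d * card (rn_sets F d Q W))"
    using card_rn_sets_ge by (simp only: of_nat_le_iff)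
  \<comment> \<open>Since \<open>q \<ge> d\<close>, the truncated difference agrees with the real
    one.\<close>
  hence "(real (card (carrier F)) - real d) ^ d \<le> fact d * real (card (rn_sets F d Q W))"
    using assms(4) by simp
  hence "\<rho> / fact d * (real (card (carrier F)) - real d) ^ d
      \<le> \<rho> / fact d * (fact d * real (card (rn_sets F d Q W)))"
    using assms(3) by (intro mult_left_mono) auto
  thus ?thesis using assms(2) by simp
qed

lemma rn_K_upper:
  assumes "G \<subseteq> rn_sets F d Q W"
  shows "rn_K F d Q W G \<le> real d - 1"
proof -
  have "real (card G) \<le> real (card (carrier F)) ^ d"
    using card_le_power[OF assms] by (metis of_nat_le_iff of_nat_power)
  hence "sqrt (real (card G) / real (card (carrier F)) ^ d) \<le> 1"
    using card_carrier_pos by simp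
  hence "(real d - 1) * sqrt (real (card G) / real (card (carrier F)) ^ d) \<le> (real d - 1) * 1"
    using d_ge_3 by (intro mult_left_mono) auto
  thus ?thesis by (simp add: rn_K_eq'[OF assms])
qed

text \<open>The two entries of the minimum cover all \<open>q\<close>. If \<open>q \<ge> 2d\<close>,
  then \<open>q - d \<ge> q/2\<close> and the density is at least \<open>\<rho> / (d! 2^d)\<close>;
  if \<open>q < 2d\<close>, a nonempty \<open>G\<close> has density at least
  \<open>1 / q^d\<close>.\<close>

lemma rn_K_lower:
  assumes G: "G \<subseteq> rn_sets F d Q W" "G \<noteq> {}" and \<rho>: "\<rho> > 0"
    and dens: "real (card G) \<ge> \<rho> * real (card (rn_sets F d Q W))"
  shows "(real d - 1) * sqrt (min (\<rho> / (fact d * 2 ^ d)) (1 / real (2 * d) ^ d)) \<le> rn_K F d Q W G"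
proof -
  define q where "q = card (carrier F)"
  have q: "q > 0" using card_carrier_pos by (simp add: q_def)
  have "min (\<rho> / (fact d * 2 ^ d)) (1 / real (2 * d) ^ d) \<le> real (card G) / real q ^ d"
  proof (cases "q \<ge> 2 * d")
    case True
    have "\<rho> / fact d * (real q / 2) ^ d \<le> \<rho> / fact d * (real q - real d) ^ d"
      using True \<rho> by (intro mult_left_mono power_mono) auto
    also have "\<dots> \<le> real (card G)"
      using density_le[OF G(1) dens \<rho>] True by (simp add: q_def)
    finally have "\<rho> / (fact d * 2 ^ d) * real q ^ d \<le> real (card G)"
      by (simp add: power_divide)
    hence "\<rho> / (fact d * 2 ^ d) \<le> real (card G) / real q ^ d" using q by (simp add: pos_le_divide_eq)
    thus ?thesis by linarith
  next
    case False
    have "finite G" using G(1) finite_rn_sets finite_subset by blast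
    hence "1 \<le> real (card G)" using G(2) by (simp add: Suc_le_eq card_gt_0_iff)
    moreover have "real q ^ d \<le> real (2 * d) ^ d" using False by (intro power_mono) auto
    ultimately have "1 / real (2 * d) ^ d \<le> real (card G) / real q ^ d"
      using q by (intro frac_le) auto
    thus ?thesis by linarith
  qed
  hence "(real d - 1) * sqrt (min (\<rho> / (fact d * 2 ^ d)) (1 / real (2 * d) ^ d))
      \<le> (real d - 1) * sqrt (real (card G) / real q ^ d)"
    using d_ge_3 by (intro mult_left_mono real_sqrt_le_mono) auto
  thus ?thesis by (simp add: rn_K_eq'[OF G(1)] q_def)
qed

text \<open>After clearing the denominator this is \<open>4 m \<le> (d - 1)^2 m\<close>, by the
  formula for \<open>K^2 q^d\<close>. For empty \<open>G\<close> the left side is 0.\<close>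

lemma rn_moderate_lower:
  assumes G: "G \<subseteq> rn_sets F d Q W"
  shows "4 * real (card (rn_points F d Q W G)) / ((rn_K F d Q W G)\<^sup>2 * real (card (carrier F)) ^ (d - 1))
    \<le> real (card (rn_spheres F d Q W))"
proof (cases "G = {}")
  case False
  define q where "q = real (card (carrier F))"
  have q: "q > 0" using card_carrier_pos by (simp add: q_def)
  have "finite G" using G finite_rn_sets finite_subset by blast
  hence m: "card G > 0" using False by (simp add: card_gt_0_iff)
  have d1: "q ^ d = q ^ (d - 1) * q" using d_ge_3 by (cases d) auto
  have K2: "(rn_K F d Q W G)\<^sup>2 * q ^ (d - 1) * q = (real d - 1)\<^sup>2 * real (card G)"
    using rn_K_square[OF G] by (simp add: q_def[symmetric] d1 mult_ac)
  have "2\<^sup>2 \<le> (real d - 1)\<^sup>2" using d_ge_3 by (intro power_mono) auto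
  hence "4 * real (card G) \<le> (real d - 1)\<^sup>2 * real (card G)" by (intro mult_right_mono) auto
  hence le: "4 * real (card G) \<le> q * ((rn_K F d Q W G)\<^sup>2 * q ^ (d - 1))"
    using K2 by (simp add: mult_ac)
  have "(rn_K F d Q W G)\<^sup>2 * q ^ (d - 1) > 0"
    using le m q by (metis less_le_trans mult_pos_pos of_nat_0_less_iff zero_less_mult_pos zero_less_numeral)
  thus ?thesis using le
    by (simp add: card_rn_points[OF G] card_rn_spheres q_def[symmetric] pos_divide_le_eq)
qed (simp add: rn_points_def)

text \<open>Let \<open>R\<close> be the right side. Then \<open>R^2 q = C^2 (d - 1)^2 m\<close>, so
  the hypothesis \<open>cube\<close> is the squared inequality \<open>q^2 \<le> R^2\<close>
  multiplied by \<open>q\<close>.\<close>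

lemma rn_moderate_upper:
  assumes G: "G \<subseteq> rn_sets F d Q W"
    and cube: "real (card (carrier F)) ^ 3 \<le> C\<^sup>2 * (real d - 1)\<^sup>2 * real (card G)" and C: "C \<ge> 0"
  shows "real (card (rn_spheres F d Q W))
    \<le> C * rn_K F d Q W G * real (card (carrier F)) powr ((real d - 1) / 2)"
proof -
  define q where "q = real (card (carrier F))"
  have q: "q > 0" using card_carrier_pos by (simp add: q_def)
  define R where "R = C * rn_K F d Q W G * q powr ((real d - 1) / 2)"
  have d1: "q ^ d = q ^ (d - 1) * q" using d_ge_3 by (cases d) auto
  have "(q powr ((real d - 1) / 2))\<^sup>2 = q powr (real (d - 1))"
    using d_ge_3 by (simp add: power2_eq_square flip: powr_add)
  hence pw: "(q powr ((real d - 1) / 2))\<^sup>2 = q ^ (d - 1)" using q by (simp add: powr_realpow)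
  have "R\<^sup>2 * q = C\<^sup>2 * ((rn_K F d Q W G)\<^sup>2 * q ^ d)"
    by (simp add: R_def power_mult_distrib pw d1)
  also have "\<dots> = C\<^sup>2 * (real d - 1)\<^sup>2 * real (card G)"
    using rn_K_square[OF G] by (simp add: q_def)
  finally have "q\<^sup>2 * q \<le> R\<^sup>2 * q" using cube by (simp add: q_def power2_eq_square power3_eq_cube)
  hence "q\<^sup>2 \<le> R\<^sup>2" using q by simp
  moreover have "R \<ge> 0" using C rn_K_nonneg[OF G] by (simp add: R_def)
  ultimately have "q \<le> R" by (rule power2_le_imp_le)
  thus ?thesis by (simp add: R_def q_def card_rn_spheres)
qed

end

theorem theorem4p9:
  fixes d :: nat
  assumes "d \<ge> 3"
  shows
    "(\<forall>(F :: 'a ring) Q W G.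
        rn_setting F d Q W \<and> G \<subseteq> rn_sets F d Q W \<longrightarrow>
        (let V = coord_space F d;
             q = real (card (carrier F));
             m = real (card G);
             P = rn_points F d Q W G;
             Sph = rn_spheres F d Q W;
             K = rn_K F d Q W G
         in (\<forall>A\<in>G. \<forall>t\<in>carrier F.
               rn_point F d Q W A \<in> sphere_points V Q (rn_sphere F d Q W t) \<longleftrightarrow> t \<in> A)
          \<and> bij_betw (rn_point F d Q W) G P
          \<and> bij_betw (rn_sphere F d Q W) (carrier F) Sph
          \<and> incidence_graph V Q P Sph =
              map_prod (rn_point F d Q W) (rn_sphere F d Q W) `
                {(A, t). A \<in> G \<and> t \<in> carrier F \<and> t \<in> A}
          \<and> incidences V Q P Sph = d * card G
          \<and> discrepancy F V Q P Sph = (real d - 1) * m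
          \<and> (G \<noteq> {} \<longrightarrow>
               discrepancy F V Q P Sph
                 = K * q powr ((real d - 1) / 2) * sqrt (real (card P) * real (card Sph))
             \<and> K = (real d - 1) * sqrt m / q powr (real d / 2)
             \<and> K\<^sup>2 * q ^ (d - 1) * real (card Sph) = (real d - 1)\<^sup>2 * m
             \<and> (real d - 1)\<^sup>2 * m \<ge> 4 * m
             \<and> K\<^sup>2 * q ^ (d - 1) * real (card Sph) \<ge> 4 * real (card P))))
   \<and> (\<forall>\<rho>::real. \<rho> > 0 \<longrightarrow>
        (\<exists>c>0. \<exists>C>0. \<forall>(F :: 'a ring) Q W G.
           rn_setting F d Q W \<and> G \<subseteq> rn_sets F d Q W \<and> G \<noteq> {} \<and>
           real (card G) \<ge> \<rho> * real (card (rn_sets F d Q W)) \<longrightarrow>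
           c \<le> rn_K F d Q W G \<and> rn_K F d Q W G \<le> C))
   \<and> (\<forall>(\<rho>::real) (C1::real).
        \<rho> > 0 \<and> (d \<ge> 4 \<and> C1 = 1 \<or> d = 3 \<and> C1 > sqrt (3 / (2 * \<rho>))) \<longrightarrow>
        (\<exists>q0. \<forall>(F :: 'a ring) Q W G.
           rn_setting F d Q W \<and> card (carrier F) \<ge> q0 \<and> G \<subseteq> rn_sets F d Q W \<and>
           real (card G) \<ge> \<rho> * real (card (rn_sets F d Q W)) \<longrightarrow>
           4 * real (card (rn_points F d Q W G)) / ((rn_K F d Q W G)\<^sup>2 * real (card (carrier F)) ^ (d - 1))
             \<le> real (card (rn_spheres F d Q W)) \<and>
           real (card (rn_spheres F d Q W))
             \<le> C1 * rn_K F d Q W G * real (card (carrier F)) powr ((real d - 1) / 2)))"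
proof (intro conjI allI impI, goal_cases)
  case (1 F Q W G)
  then interpret rn_construction F d Q W using assms by unfold_locales auto
  have G: "G \<subseteq> rn_sets F d Q W" using 1 by simp
  define q where "q = real (card (carrier F))"
  have q: "q > 0" using card_carrier_pos by (simp add: q_def)
  have four: "4 * real (card G) \<le> (real d - 1)\<^sup>2 * real (card G)"
  proof (intro mult_right_mono)
    have "2\<^sup>2 \<le> (real d - 1)\<^sup>2" using assms by (intro power_mono) auto
    thus "4 \<le> (real d - 1)\<^sup>2" by simp
  qed auto
  have "q ^ d = q ^ (d - 1) * q" using assms by (cases d) auto
  hence K2: "(rn_K F d Q W G)\<^sup>2 * q ^ (d - 1) * q = (real d - 1)\<^sup>2 * real (card G)"
    using rn_K_square[OF G] by (simp add: q_def[symmetric] mult_ac)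
  \<comment> \<open>\<open>K\<close> is defined as a quotient; nonemptiness of \<open>G\<close>
    keeps its denominator nonzero, so the defining equation holds.\<close>
  have disc: "discrepancy F V Q (rn_points F d Q W G) (rn_spheres F d Q W)
      = rn_K F d Q W G * q powr ((real d - 1) / 2) *
        sqrt (real (card (rn_points F d Q W G)) * real (card (rn_spheres F d Q W)))"
    if "G \<noteq> {}"
  proof -
    have "finite G" using G finite_rn_sets finite_subset by blast
    hence "q powr ((real d - 1) / 2) * sqrt (real (card (rn_points F d Q W G)) * real (card (rn_spheres F d Q W))) \<noteq> 0"
      using that q by (simp add: card_rn_points[OF G] card_rn_spheres q_def[symmetric])
    thus ?thesis by (simp add: rn_K_def K_const_def q_def[symmetric])
  qed
  have "bij_betw point G (rn_points F d Q W G)"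
    unfolding rn_points_def using inj_on_subset[OF point_inj G] by (simp add: bij_betw_def)
  moreover have "bij_betw sphere (carrier F) (rn_spheres F d Q W)"
    unfolding rn_spheres_def using sphere_inj by (simp add: bij_betw_def)
  moreover have "\<forall>A\<in>G. \<forall>t\<in>carrier F. point A \<in> sphere_points V Q (sphere t) \<longleftrightarrow> t \<in> A"
    using point_in_sphere_iff G by blast
  ultimately show ?case
    unfolding Let_def q_def[symmetric]
    using incidence_graph_rn[OF G] incidences_rn[OF G] discrepancy_rn[OF G] disc
      rn_K_eq[OF G, folded q_def] K2 four card_rn_points[OF G] card_rn_spheres[folded q_def]
    by (simp add: q_def[symmetric])
next
  case (2 \<rho>)
  \<comment> \<open>The lower constant involves only \<open>d\<close> and \<open>\<rho>\<close>,
    hence is uniform over all fields.\<close>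
  let ?c = "(real d - 1) * sqrt (min (\<rho> / (fact d * 2 ^ d)) (1 / real (2 * d) ^ d))"
  have "?c > 0" using 2 assms by simp
  moreover have "real d - 1 > 0" using assms by simp
  moreover have "?c \<le> rn_K F d Q W G \<and> rn_K F d Q W G \<le> real d - 1"
    if "rn_setting F d Q W \<and> G \<subseteq> rn_sets F d Q W \<and> G \<noteq> {} \<and>
        real (card G) \<ge> \<rho> * real (card (rn_sets F d Q W))" for F :: "'a ring" and Q W G
  proof -
    interpret rn_construction F d Q W using that assms by unfold_locales auto
    show ?thesis using rn_K_lower[of G \<rho>] rn_K_upper[of G] that 2 by blast
  qed
  ultimately show ?case by blast
next
  case (3 \<rho> C)
  \<comment> \<open>The density bound gives \<open>C^2 (d - 1)^2 m \<ge> a (q - d)^d\<close>. For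
    \<open>d = 3\<close> one has \<open>a = 2 \<rho> C^2 / 3\<close>, and \<open>a > 1\<close> is
    exactly the threshold on \<open>C\<close>.\<close>
  define a where "a = C\<^sup>2 * (real d - 1)\<^sup>2 * \<rho> / fact d"
  have \<rho>: "\<rho> > 0" and C: "C > 0"
    using 3 by (auto intro: le_less_trans[of 0 "sqrt (3 / (2 * \<rho>))"])
  hence "a > 0" using assms by (simp add: a_def)
  moreover have "d \<ge> 4 \<or> d = 3 \<and> a > 1"
  proof (cases "d = 3")
    case True
    hence "sqrt (3 / (2 * \<rho>)) < C" using 3 by auto
    hence "(sqrt (3 / (2 * \<rho>)))\<^sup>2 < C\<^sup>2" using \<rho> by (intro power_strict_mono) auto
    hence "3 / (2 * \<rho>) < C\<^sup>2" using \<rho> by simp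
    hence "a > 1" using True \<rho> by (simp add: a_def field_simps fact_numeral)
    thus ?thesis using True by simp
  qed (use assms in auto)
  ultimately obtain q1 where q1: "\<And>n. n \<ge> q1 \<Longrightarrow> real n ^ 3 \<le> a * (real n - real d) ^ d"
    using eventually_cube_le[of a d "real d"] by (auto simp: eventually_sequentially)
  show ?case
  \<comment> \<open>\<open>q1\<close> serves the cubic comparison, and \<open>d\<close> the passage
    to real differences in \<open>density_le\<close>.\<close>
  proof (intro exI[of _ "max q1 d"] allI impI)
    fix F :: "'a ring" and Q W G
    assume A: "rn_setting F d Q W \<and> card (carrier F) \<ge> max q1 d \<and> G \<subseteq> rn_sets F d Q W \<and>
      real (card G) \<ge> \<rho> * real (card (rn_sets F d Q W))"
    then interpret rn_construction F d Q W using assms by unfold_locales auto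
    have "real (card (carrier F)) ^ 3 \<le> a * (real (card (carrier F)) - real d) ^ d"
      using A by (intro q1) auto
    also have "\<dots> = C\<^sup>2 * (real d - 1)\<^sup>2 * (\<rho> / fact d * (real (card (carrier F)) - real d) ^ d)"
      by (simp add: a_def)
    also have "\<dots> \<le> C\<^sup>2 * (real d - 1)\<^sup>2 * real (card G)"
      using A \<rho> by (intro mult_left_mono density_le) auto
    finally show "4 * real (card (rn_points F d Q W G)) / ((rn_K F d Q W G)\<^sup>2 * real (card (carrier F)) ^ (d - 1))
          \<le> real (card (rn_spheres F d Q W)) \<and>
        real (card (rn_spheres F d Q W))
          \<le> C * rn_K F d Q W G * real (card (carrier F)) powr ((real d - 1) / 2)"
      using rn_moderate_lower rn_moderate_upper A C by simp
  qed
qed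

end
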